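(* Let $\mu=(\mu_1,\ldots,\mu_l)$ be a composition of $m$ (positive integers with sum $m$) with code $\alpha$. Suppose that $\alpha$ can be written as $$\alpha=\cdots\beta_3\beta_2\beta_1L^kU\gamma_1\gamma_2\gamma_3\cdots$$ for some integer $k\ge1$, where every $\beta_i\in\{R,U\}$, $\beta_1=U$, and the $\gamma_i$ are letters. Let $j$ be the smallest integer such that $\beta_{k+j}\cdots\beta_2\beta_1$ contains $k$ letters $R$. (1) If $\beta_{k+j+1}=U$, then $Y_{-\mu_1}Y_{-\mu_2}\cdots Y_{-\mu_l}=0$. (2) If $\beta_{k+j+1}=R$, then the reduced form of the word $\cdots\beta_{k+j+2}\beta_{k+j+1}U\beta_{k+j}\cdots\beta_2\beta_1L^k\gamma_1\gamma_2\cdots$ is the code of a composition $\nu=(\nu_1,\ldots,\nu_l)$ of $m$, and $Y_{-\mu_1}\cdots Y_{-\mu_l}=(-1)^jY_{-\nu_1}\cdots Y_{-\nu_l}$.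
   Context: $\Lambda^-=\mathbb{C}[p_1,p_3,p_5,\ldots]$ is the ring generated by the odd power sums $p_{2k-1}=\sum_i x_i^{2k-1}$. The operators $Y_n$ ($n\in\mathbb{Z}$) on $\Lambda^-$ are defined by $$Y(t)=\sum_{n\in\mathbb{Z}}Y_nt^{-n}=\exp\Big(\sum_{k\ge1}\frac{2t^{2k-1}}{2k-1}p_{2k-1}\Big)\exp\Big(-\sum_{k\ge1}t^{-(2k-1)}\frac{\partial}{\partial p_{2k-1}}\Big),$$ so that the Schur $Q$-function of a strict partition $\lambda$ is $Q_\lambda=Y_{-\lambda_1}\cdots Y_{-\lambda_l}\cdot1$; products of operators denote composition. Codes: words are bi-infinite sequences over $\{R,L,U\}$. For integers $a,b\ge0$ let $H(a,b)=R^{b-a}$ if $b\ge a$ and $H(a,b)=L^{a-b}$ if $a>b$. The code of a composition $\mu=(\mu_1,\ldots,\mu_l)$ of positive integers is the word $$\cdots UUU\,R^{\mu_l}\,U\,H(\mu_l,\mu_{l-1})\,U\,H(\mu_{l-1},\mu_{l-2})\,U\cdots U\,H(\mu_2,\mu_1)\,U\,RRR\cdots,$$ i.e. the sequence of unit right ($R$), left ($L$), up ($U$) steps along the right boundary of the diagram with left-justified rows $\mu_1,\ldots,\mu_l$ (top to bottom) in the fourth quadrant, extended by the negative $y$-axis and positive $x$-axis. The reduced form of a word is obtained by repeatedly deleting adjacent pairs $LR$ or $RL$; codes of compositions are reduced and distinct compositions have distinct codes. *)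

theory Defs
  imports Complex_Main "HOL-Library.Poly_Mapping"
begin

section \<open>The ring of odd power sums and the operators \<open>Y\<^sub>n\<close>\<close>

text \<open>
  The odd power sums \<open>p\<^sub>1, p\<^sub>3, p\<^sub>5, \<dots>\<close> are algebraically independent, so the ring they
  generate is the polynomial ring over the complex numbers in countably many variables; the
  variable with index \<open>i\<close> stands for \<open>p\<^sub>2\<^sub>i\<^sub>+\<^sub>1\<close>. A monomial is a finitely supported exponent vector.
\<close>

type_synonym odd_ring = "(nat \<Rightarrow>\<^sub>0 nat) \<Rightarrow>\<^sub>0 complex"

definition scalar :: "complex \<Rightarrow> odd_ring" where
  "scalar c = Poly_Mapping.single 0 c"

definition odd_var :: "nat \<Rightarrow> odd_ring" where
  "odd_var i = Poly_Mapping.single (Poly_Mapping.single i 1) 1"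

definition odd_deriv :: "nat \<Rightarrow> odd_ring \<Rightarrow> odd_ring" where
  "odd_deriv i f = (\<Sum>x\<in>Poly_Mapping.keys f.
     Poly_Mapping.single (x - Poly_Mapping.single i 1)
       (of_nat (Poly_Mapping.lookup x i) * Poly_Mapping.lookup f x))"

text \<open>
  Formal power series whose coefficients are operators on the ring, with the Cauchy product
  built from composition of operators.
\<close>

type_synonym op_series = "nat \<Rightarrow> odd_ring \<Rightarrow> odd_ring"

definition ops_one :: op_series where
  "ops_one n = (if n = 0 then id else (\<lambda>f. 0))"

definition ops_mult :: "op_series \<Rightarrow> op_series \<Rightarrow> op_series" where
  "ops_mult A B n = (\<lambda>f. \<Sum>i\<le>n. A i (B (n - i) f))"

primrec ops_power :: "op_series \<Rightarrow> nat \<Rightarrow> op_series" where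
  "ops_power A 0 = ops_one"
| "ops_power A (Suc r) = ops_mult A (ops_power A r)"

text \<open>
  The exponential \<open>\<Sum>\<^sub>r A\<^sup>r / r!\<close> of a series with zero constant coefficient. The coefficient
  of degree \<open>n\<close> of \<open>A\<^sup>r\<close> then vanishes for \<open>r > n\<close>, which is why the sum stops at \<open>n\<close>.
\<close>

definition ops_exp :: "op_series \<Rightarrow> op_series" where
  "ops_exp A n = (\<lambda>f. \<Sum>r\<le>n. scalar (1 / fact r) * ops_power A r n f)"

text \<open>
  The exponents of the two factors of \<open>Y(t)\<close>: the first as a series in \<open>t\<close>, the second as a
  series in \<open>t\<^sup>-\<^sup>1\<close>. For odd \<open>n\<close> the generator \<open>p\<^sub>n\<close> has index \<open>n div 2\<close>.
\<close>

definition creation_exponent :: op_series where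
  "creation_exponent n =
     (if odd n then (\<lambda>f. scalar (2 / of_nat n) * odd_var (n div 2) * f) else (\<lambda>f. 0))"

definition annihilation_exponent :: op_series where
  "annihilation_exponent n =
     (if odd n then (\<lambda>f. - odd_deriv (n div 2) f) else (\<lambda>f. 0))"

text \<open>
  \<open>Y n\<close> is the coefficient of \<open>t\<^sup>-\<^sup>n\<close>: degree \<open>a\<close> in the first factor is paired with degree
  \<open>b\<close> in the second where \<open>b - a = n\<close>. The coefficient of degree \<open>b\<close> of the second factor lowers
  the weight (with \<open>p\<^sub>i\<close> of weight \<open>i\<close>) by \<open>b\<close>, so only finitely many \<open>b\<close> contribute for each
  \<open>f\<close>, and \<open>Sum_any\<close> is their sum.
\<close>

definition Y :: "int \<Rightarrow> odd_ring \<Rightarrow> odd_ring" where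
  "Y n f = Sum_any (\<lambda>b::nat. if n \<le> int b
     then ops_exp creation_exponent (nat (int b - n)) (ops_exp annihilation_exponent b f)
     else 0)"

definition Y_product :: "nat list \<Rightarrow> odd_ring \<Rightarrow> odd_ring" where
  "Y_product \<mu> = foldr (\<lambda>a F. Y (- int a) \<circ> F) \<mu> id"


section \<open>Bi-infinite words and codes of compositions\<close>

datatype letter = R | L | U

text \<open>A word is read up to a shift of the indices.\<close>

type_synonym word = "int \<Rightarrow> letter"

definition same_word :: "word \<Rightarrow> word \<Rightarrow> bool" where
  "same_word v w \<longleftrightarrow> (\<exists>s. \<forall>n. v n = w (n + s))"

text \<open>
  \<open>biword \<beta> xs \<gamma>\<close> is the word \<open>\<dots> \<beta>\<^sub>3 \<beta>\<^sub>2 \<beta>\<^sub>1 xs \<gamma>\<^sub>1 \<gamma>\<^sub>2 \<gamma>\<^sub>3 \<dots>\<close>; the values \<open>\<beta> 0\<close> and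
  \<open>\<gamma> 0\<close> are not used.
\<close>

definition biword :: "(nat \<Rightarrow> letter) \<Rightarrow> letter list \<Rightarrow> (nat \<Rightarrow> letter) \<Rightarrow> word" where
  "biword \<beta> xs \<gamma> n =
     (if n < 0 then \<beta> (nat (- n))
      else if n < int (length xs) then xs ! nat n
      else \<gamma> (nat n - length xs + 1))"

text \<open>The finite word \<open>\<beta>\<^sub>n \<dots> \<beta>\<^sub>2 \<beta>\<^sub>1\<close>.\<close>

definition segment :: "(nat \<Rightarrow> letter) \<Rightarrow> nat \<Rightarrow> letter list" where
  "segment \<beta> n = rev (map \<beta> [1..<n + 1])"

definition H :: "nat \<Rightarrow> nat \<Rightarrow> letter list" where
  "H a b = (if a \<le> b then replicate (b - a) R else replicate (a - b) L)"

text \<open>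
  The boundary path is read from the bottom row upwards, hence \<open>rev\<close> below; the first block
  \<open>H(0, \<mu>\<^sub>l)\<close> is \<open>R\<close> repeated \<open>\<mu>\<^sub>l\<close> times.
\<close>

primrec boundary_steps :: "nat \<Rightarrow> nat list \<Rightarrow> letter list" where
  "boundary_steps a [] = []"
| "boundary_steps a (b # bs) = H a b @ [U] @ boundary_steps b bs"

definition code :: "nat list \<Rightarrow> word" where
  "code \<mu> = biword (\<lambda>_. U) (boundary_steps 0 (rev \<mu>)) (\<lambda>_. R)"

definition composition_of :: "nat \<Rightarrow> nat list \<Rightarrow> bool" where
  "composition_of m \<mu> \<longleftrightarrow> (\<forall>a\<in>set \<mu>. 0 < a) \<and> sum_list \<mu> = m"

definition cancels_at :: "word \<Rightarrow> int \<Rightarrow> bool" where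
  "cancels_at w i \<longleftrightarrow> w i = L \<and> w (i + 1) = R \<or> w i = R \<and> w (i + 1) = L"

definition delete_pair :: "word \<Rightarrow> int \<Rightarrow> word" where
  "delete_pair w i = (\<lambda>n. if n < i then w n else w (n + 2))"

definition deletes :: "word \<Rightarrow> word \<Rightarrow> bool" where
  "deletes v w \<longleftrightarrow> (\<exists>i. cancels_at v i \<and> w = delete_pair v i)"

definition reduced :: "word \<Rightarrow> bool" where
  "reduced w \<longleftrightarrow> (\<forall>i. \<not> cancels_at w i)"

definition is_reduced_form :: "word \<Rightarrow> word \<Rightarrow> bool" where
  "is_reduced_form v w \<longleftrightarrow> deletes\<^sup>*\<^sup>* v w \<and> reduced w"

text \<open>Deletion has the diamond property, so a word has at most one reduced form.\<close>

lemma delete_pair_diamond: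
  assumes "cancels_at v i" "cancels_at v k" "i < k"
  shows "delete_pair v i = delete_pair v k \<or>
    (\<exists>w. deletes (delete_pair v i) w \<and> deletes (delete_pair v k) w)"
proof (cases "k = i + 1")
  case True
  have "v (i + 2) = v i"
    using assms True by (auto simp: cancels_at_def add.assoc)
  then have "delete_pair v i n = delete_pair v k n" for n
    using True by (cases "n = i") (auto simp: delete_pair_def)
  then show ?thesis by blast
next
  case False
  with assms(3) have far: "i + 2 \<le> k" by simp
  have 1: "cancels_at (delete_pair v i) (k - 2)"
    using assms(2) far by (auto simp: cancels_at_def delete_pair_def add.commute)
  have 2: "cancels_at (delete_pair v k) i"
    using assms(1) far by (auto simp: cancels_at_def delete_pair_def)
  have "delete_pair (delete_pair v i) (k - 2) = delete_pair (delete_pair v k) i"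
    using far by (auto simp: delete_pair_def fun_eq_iff)
  with 1 2 show ?thesis unfolding deletes_def by metis
qed

lemma deletes_diamond:
  assumes "deletes v a" "deletes v b"
  shows "a = b \<or> (\<exists>w. deletes a w \<and> deletes b w)"
proof -
  obtain i k where ik: "cancels_at v i" "a = delete_pair v i"
      "cancels_at v k" "b = delete_pair v k"
    using assms unfolding deletes_def by blast
  consider "i < k" | "i = k" | "k < i" by linarith
  then show ?thesis
    by cases (use ik delete_pair_diamond in metis)+
qed

lemma deletes_strip:
  assumes "deletes\<^sup>*\<^sup>* v b" "deletes v a"
  shows "\<exists>w. deletes\<^sup>*\<^sup>* a w \<and> (b = w \<or> deletes b w)"
  using assms(1)
proof (induction rule: rtranclp_induct)
  case base
  then show ?case using assms(2) by blast
next
  case (step b c)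
  then obtain w where w: "deletes\<^sup>*\<^sup>* a w" "b = w \<or> deletes b w" by blast
  show ?case
    using w(2)
  proof
    assume "b = w"
    with w(1) step.hyps(2) show ?thesis by (metis rtranclp.rtrancl_into_rtrancl)
  next
    assume "deletes b w"
    from deletes_diamond[OF this step.hyps(2)] w(1) show ?thesis
      by (metis rtranclp.rtrancl_into_rtrancl)
  qed
qed

lemma reduced_form_unique:
  assumes "is_reduced_form v a" "is_reduced_form v b"
  shows "a = b"
proof -
  have stuck: "\<not> deletes w x" if "reduced w" for w x
    using that by (auto simp: reduced_def deletes_def)
  have "deletes\<^sup>*\<^sup>* v a" using assms(1) by (simp add: is_reduced_form_def)
  then have "deletes\<^sup>*\<^sup>* v b \<Longrightarrow> a = b"
  proof (induction rule: converse_rtranclp_induct)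
    case base
    then show ?case
      using stuck assms(1) by (metis converse_rtranclpE is_reduced_form_def)
  next
    case (step v u)
    from deletes_strip[OF step.prems step.hyps(1)] show ?case
      using stuck assms(2) step.IH by (metis is_reduced_form_def)
  qed
  then show ?thesis using assms(2) by (simp add: is_reduced_form_def)
qed

end

theory Submission
  imports Defs "HOL-Computational_Algebra.Formal_Power_Series"
begin

text \<open>
  For positive \<open>a\<close> and \<open>b\<close> the operators \<open>Y\<^sub>-\<^sub>a\<close> and \<open>Y\<^sub>-\<^sub>b\<close> anticommute. Moving the annihilation
  factor of \<open>Y\<^sub>-\<^sub>a\<close> past the creation factor of \<open>Y\<^sub>-\<^sub>b\<close> replaces the product of the coefficients
  \<open>q\<^sub>x q\<^sub>y\<close> of \<open>Q(t) = exp (\<Sum>\<^sub>k 2 p\<^sub>k t\<^sup>k / k)\<close> (\<open>k\<close> odd) by \<open>\<Sum>\<^sub>i \<kappa>\<^sub>i q\<^sub>x\<^sub>+\<^sub>i q\<^sub>y\<^sub>-\<^sub>i\<close>, where \<open>\<kappa>\<^sub>i\<close> are the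
  coefficients of \<open>(1 - x) / (1 + x)\<close>, and this is antisymmetric in \<open>x, y\<close> because \<open>Q(t) Q(-t) = 1\<close>.

  In the code, the letters to the left of \<open>L\<^sup>kU\<close> describe rows that weakly increase upwards, and
  \<open>L\<^sup>kU\<close> is the end of the first row that is shorter than the row below it, namely by \<open>k\<close>; let \<open>z\<close>
  be its length. The segment with \<open>k\<close> letters \<open>R\<close> contains exactly the \<open>j\<close> lower rows longer than \<open>z\<close>, so
  moving \<open>U\<close> to its left moves the row \<open>z\<close> below these \<open>j\<close> rows and costs the sign \<open>(-1)\<^sup>j\<close>. The
  letter before the segment is \<open>U\<close> if and only if the next row equals \<open>z\<close>, and then
  \<open>Y\<^sub>-\<^sub>z Y\<^sub>-\<^sub>z = 0\<close>.
\<close>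

subsection \<open>Exponentials of commuting operators\<close>

lemma scalar_fact_mult: "scalar (1 / fact (Suc r)) * of_nat (Suc r) = scalar (1 / fact r)"
proof -
  have "scalar (1 / fact (Suc r)) * of_nat (Suc r) = scalar (1 / fact (Suc r) * of_nat (Suc r))"
    by (simp only: scalar_def single_of_nat [symmetric] mult_single add_0)
  also have "1 / fact (Suc r) * of_nat (Suc r) = (1 / fact r :: complex)"
    by (simp add: divide_simps del: of_nat_Suc)
  finally show ?thesis .
qed

lemma additive_of_nat_mult:
  fixes T :: "'a::ring_1 \<Rightarrow> 'b::ring_1"
  assumes "additive T"
  shows "T (of_nat n * f) = of_nat n * T f"
proof -
  interpret additive T by (rule assms)
  show ?thesis by (induction n) (simp_all add: zero add distrib_right)
qed

lemma sum_convolution_swap: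
  fixes n :: nat
  shows "(\<Sum>i\<le>n. \<Sum>k\<le>n - i. F i k) = (\<Sum>k\<le>n. \<Sum>i\<le>n - k. F i k)"
  unfolding sum.Sigma[OF finite_atMost ballI[OF finite_atMost]]
  by (rule sum.reindex_bij_witness[of _ prod.swap prod.swap]) auto

lemma sum_convolution_diagonal:
  fixes n :: nat
  shows "(\<Sum>i\<le>n. \<Sum>k\<le>n - i. F i k) = (\<Sum>m\<le>n. \<Sum>i\<le>m. F i (m - i))"
  unfolding sum.Sigma[OF finite_atMost ballI[OF finite_atMost]]
  by (rule sum.reindex_bij_witness[of _ "\<lambda>(m, i). (i, m - i)" "\<lambda>(i, k). (i + k, i)"]) auto

text \<open>Both exponents of \<open>Y(t)\<close> are series of commuting linear operators with zero
  constant term, which suffices to treat their exponentials like those of scalar power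
  series.\<close>

locale commuting_ops =
  fixes A :: op_series
  assumes additive: "additive (A n)"
    and scal: "A n (scalar c * f) = scalar c * A n f"
    and comm: "A m (A n f) = A n (A m f)"
    and at_0: "A 0 f = 0"
begin

lemmas add = additive.add[OF additive]
lemmas zero = additive.zero[OF additive]
lemmas sum = additive.sum[OF additive]
lemmas of_nat = additive_of_nat_mult[OF additive]

lemma ops_power_eq_0:
  "n < r \<Longrightarrow> ops_power A r n f = 0"
proof (induction r arbitrary: n f)
  case (Suc r)
  have "A i (ops_power A r (n - i) f) = 0" if "i \<le> n" for i
    using Suc that by (cases "i = 0") (simp_all add: at_0 zero)
  then show ?case by (simp add: ops_mult_def)
qed simp

text \<open>Coefficient form of \<open>t d/dt A^(r+1) = (r+1) (t dA/dt) A^r\<close>. It follows from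
  the Leibniz rule by induction; commutativity moves the differentiated factor to the front.\<close>

lemma ops_power_Suc_rec:
  "of_nat n * ops_power A (Suc r) n f =
     of_nat (Suc r) * (\<Sum>k\<le>n. of_nat k * A k (ops_power A r (n - k) f))"
proof (induction r arbitrary: n f)
  case 0
  have one: "A i (ops_one (n - i) f) = (if i = n then A n f else 0)" if "i \<le> n" for i
    using that by (auto simp: ops_one_def zero)
  have "(\<Sum>k\<le>n. of_nat k * A k (ops_one (n - k) f)) =
      (\<Sum>k\<le>n. if k = n then of_nat n * A n f else 0)"
    by (rule sum.cong) (auto simp: one)
  then show ?case
    by (simp add: ops_mult_def [of A] one)
next
  case (Suc r)
  let ?P = "ops_power A"
  have "of_nat n * ?P (Suc (Suc r)) n f = (\<Sum>i\<le>n. of_nat n * A i (?P (Suc r) (n - i) f))"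
    by (simp add: ops_mult_def [of A] sum_distrib_left)
  \<comment> \<open>Leibniz rule: the weight \<open>n\<close> is split as \<open>i + (n - i)\<close>
    between the first factor and the remaining power.\<close>
  also have "\<dots> = (\<Sum>i\<le>n. of_nat i * A i (?P (Suc r) (n - i) f)) +
      (\<Sum>i\<le>n. A i (of_nat (n - i) * ?P (Suc r) (n - i) f))"
    unfolding sum.distrib [symmetric] of_nat distrib_right [symmetric] of_nat_add [symmetric]
    by (intro sum.cong) auto
  also have "(\<Sum>i\<le>n. A i (of_nat (n - i) * ?P (Suc r) (n - i) f)) =
      (\<Sum>i\<le>n. \<Sum>k\<le>n - i. of_nat (Suc r) * (of_nat k * A i (A k (?P r (n - i - k) f))))"
    unfolding Suc.IH by (simp only: of_nat sum sum_distrib_left)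
  also have "\<dots> =
      (\<Sum>k\<le>n. \<Sum>i\<le>n - k. of_nat (Suc r) * (of_nat k * A k (A i (?P r (n - k - i) f))))"
  proof (rule trans [OF sum_convolution_swap], intro sum.cong refl arg_cong2 [of _ _ _ _ "(*)"])
    fix i k
    show "A i (A k (?P r (n - i - k) f)) = A k (A i (?P r (n - k - i) f))"
      by (simp only: comm [of i k] diff_commute [of n i k])
  qed
  also have "\<dots> = of_nat (Suc r) * (\<Sum>k\<le>n. of_nat k * A k (?P (Suc r) (n - k) f))"
    by (simp only: ops_power.simps(2) ops_mult_def [of A] sum sum_distrib_left)
  finally show ?case by (simp only: of_nat_Suc[of "Suc r"]) (simp add: distrib_right)
qed

lemma ops_exp_upto:
  assumes "n \<le> N"
  shows "ops_exp A n f = (\<Sum>r\<le>N. scalar (1 / fact r) * ops_power A r n f)"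
  unfolding ops_exp_def using assms
  by (intro sum.mono_neutral_left) (auto simp: ops_power_eq_0)

lemma ops_exp_0: "ops_exp A 0 f = f"
  by (simp add: ops_exp_def scalar_def ops_one_def)

text \<open>The differential equation \<open>t d/dt exp A = (t dA/dt) exp A\<close> by coefficients.
  Since \<open>n > 0\<close> can be cancelled, it and \<open>ops_exp_0\<close> determine the
  exponential, so facts about it follow by strong induction on the degree.\<close>

lemma ops_exp_rec:
  "of_nat n * ops_exp A n f = (\<Sum>k\<le>n. of_nat k * A k (ops_exp A (n - k) f))"
proof -
  let ?P = "ops_power A"
  \<comment> \<open>One extra power is included so that dropping \<open>r = 0\<close>, whose term is
    zero, and shifting the index leaves the range \<open>r \<le> n\<close>.\<close>
  have "of_nat n * ops_exp A n f =
      (\<Sum>r\<le>Suc n. scalar (1 / fact r) * (of_nat n * ?P r n f))"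
    by (simp only: ops_exp_upto[of n "Suc n"] le_Suc_eq order_refl simp_thms sum_distrib_left
        mult.left_commute)
  also have "\<dots> = (\<Sum>r\<le>n. scalar (1 / fact (Suc r)) * (of_nat n * ?P (Suc r) n f))"
    by (subst sum.atMost_Suc_shift) (simp add: ops_one_def)
  also have "\<dots> = (\<Sum>r\<le>n. \<Sum>k\<le>n. of_nat k * A k (scalar (1 / fact r) * ?P r (n - k) f))"
    unfolding ops_power_Suc_rec mult.assoc [symmetric] scalar_fact_mult
    by (simp add: sum_distrib_left scal ac_simps)
  also have "\<dots> = (\<Sum>k\<le>n. \<Sum>r\<le>n. of_nat k * A k (scalar (1 / fact r) * ?P r (n - k) f))"
    by (rule sum.swap)
  also have "\<dots> = (\<Sum>k\<le>n. of_nat k * A k (ops_exp A (n - k) f))"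
    by (simp add: ops_exp_upto[of _ n] sum sum_distrib_left)
  finally show ?thesis .
qed

text \<open>Both sides satisfy the recursion with the same initial value. The induction hypothesis
  covers \<open>k > 0\<close>, and \<open>at_0\<close> disposes of \<open>k = 0\<close>.\<close>

lemma ops_exp_commutes:
  assumes T: "additive T"
    and comm': "\<And>k f. T (A k f) = A k (T f)"
  shows "ops_exp A n (T f) = T (ops_exp A n f)"
proof (induction n arbitrary: f rule: less_induct)
  case (less n)
  show ?case
  proof (cases "n = 0")
    case False
    have "A k (ops_exp A (n - k) (T f)) = T (A k (ops_exp A (n - k) f))" if "k \<le> n" for k
      using less that by (cases "k = 0") (simp_all add: at_0 comm' additive.zero[OF T])
    then have "of_nat n * ops_exp A n (T f) = T (of_nat n * ops_exp A n f)"
      unfolding ops_exp_rec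
      by (simp add: additive.sum[OF T] additive_of_nat_mult[OF T])
    then show ?thesis
      using False by (simp add: additive_of_nat_mult[OF T])
  qed (simp add: ops_exp_0)
qed

lemma additive_ops_exp: "additive (ops_exp A n)"
proof
  fix f g
  show "ops_exp A n (f + g) = ops_exp A n f + ops_exp A n g"
  proof (induction n rule: less_induct)
    case (less n)
    show ?case
    proof (cases "n = 0")
      case False
      have "A k (ops_exp A (n - k) (f + g)) =
          A k (ops_exp A (n - k) f) + A k (ops_exp A (n - k) g)" if "k \<le> n" for k
        using less that by (cases "k = 0") (simp_all add: at_0 add)
      then have "of_nat n * ops_exp A n (f + g) = of_nat n * (ops_exp A n f + ops_exp A n g)"
        unfolding ops_exp_rec distrib_left by (simp add: sum.distrib distrib_left)
      then show ?thesis
        using False by simp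
    qed (simp add: ops_exp_0)
  qed
qed

lemma ops_exp_ops_exp_commute:
  "ops_exp A m (ops_exp A n f) = ops_exp A n (ops_exp A m f)"
proof (rule ops_exp_commutes [OF additive_ops_exp])
  show "ops_exp A n (A k f) = A k (ops_exp A n f)" for k f
    by (rule ops_exp_commutes [OF additive comm])
qed

end

subsection \<open>Multiplication and differentiation\<close>

lemma lookup_single_mult_add:
  fixes y :: "'a \<Rightarrow>\<^sub>0 nat" and f :: "('a \<Rightarrow>\<^sub>0 nat) \<Rightarrow>\<^sub>0 'b::comm_semiring_1"
  shows "Poly_Mapping.lookup (Poly_Mapping.single y c * f) (y + x) = c * Poly_Mapping.lookup f x"
proof -
  have "Poly_Mapping.lookup (Poly_Mapping.single y c * f) (y + x) =
      (\<Sum>z. (c when y = z) * (\<Sum>q. Poly_Mapping.lookup f q when y + x = z + q))"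
    by (simp add: lookup_mult lookup_single)
  also have "\<dots> = c * Poly_Mapping.lookup f x"
    by (simp add: when_mult)
  finally show ?thesis .
qed

lemma lookup_single_mult_eq_0:
  fixes y :: "'a \<Rightarrow>\<^sub>0 nat" and f :: "('a \<Rightarrow>\<^sub>0 nat) \<Rightarrow>\<^sub>0 'b::comm_semiring_1"
  assumes "\<And>q. x \<noteq> y + q"
  shows "Poly_Mapping.lookup (Poly_Mapping.single y c * f) x = 0"
proof -
  have "Poly_Mapping.lookup (Poly_Mapping.single y c * f) x =
      (\<Sum>z. (c when y = z) * (\<Sum>q. Poly_Mapping.lookup f q when x = z + q))"
    by (simp add: lookup_mult lookup_single)
  also have "\<dots> = 0"
    by (simp add: when_mult assms)
  finally show ?thesis .
qed

lemma lookup_scalar_mult: "Poly_Mapping.lookup (scalar c * f) x = c * Poly_Mapping.lookup f x"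
  using lookup_single_mult_add[of 0 c f x] by (simp add: scalar_def)

lemma single_1_add_minus:
  "0 < Poly_Mapping.lookup x i \<Longrightarrow> Poly_Mapping.single i 1 + (x - Poly_Mapping.single i 1) = x"
  for x :: "nat \<Rightarrow>\<^sub>0 nat"
  by (rule poly_mapping_eqI) (auto simp: lookup_add lookup_minus lookup_single when_def)

lemma lookup_odd_var_mult:
  "Poly_Mapping.lookup (odd_var i * f) x =
     (if 0 < Poly_Mapping.lookup x i then Poly_Mapping.lookup f (x - Poly_Mapping.single i 1) else 0)"
proof (cases "0 < Poly_Mapping.lookup x i")
  case True
  then show ?thesis
    using lookup_single_mult_add[of "Poly_Mapping.single i 1" 1 f "x - Poly_Mapping.single i 1"]
    unfolding single_1_add_minus[OF True] by (simp add: odd_var_def)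
next
  case False
  then show ?thesis
    unfolding odd_var_def by (subst lookup_single_mult_eq_0) (auto simp: lookup_add)
qed

lemma lookup_odd_deriv:
  "Poly_Mapping.lookup (odd_deriv i f) x =
     of_nat (Poly_Mapping.lookup x i + 1) * Poly_Mapping.lookup f (x + Poly_Mapping.single i 1)"
proof -
  let ?e = "Poly_Mapping.single i (1::nat)"
  have "Poly_Mapping.lookup (odd_deriv i f) x = (\<Sum>y\<in>Poly_Mapping.keys f.
      (of_nat (Poly_Mapping.lookup y i) * Poly_Mapping.lookup f y when y - ?e = x))"
    by (simp add: odd_deriv_def lookup_sum lookup_single)
  also have "\<dots> = (\<Sum>y\<in>Poly_Mapping.keys f.
      if y = x + ?e then of_nat (Poly_Mapping.lookup x i + 1) * Poly_Mapping.lookup f y else 0)"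
  proof (rule sum.cong [OF refl])
    fix y
    show "(of_nat (Poly_Mapping.lookup y i) * Poly_Mapping.lookup f y when y - ?e = x) =
      (if y = x + ?e then of_nat (Poly_Mapping.lookup x i + 1) * Poly_Mapping.lookup f y else 0)"
    \<comment> \<open>Subtraction of exponents is truncated: a monomial without the variable may
      satisfy \<open>y - ?e = x\<close>, but then its factor is zero.\<close>
    proof (cases "Poly_Mapping.lookup y i = 0")
      case True
      then have "y \<noteq> x + ?e" by (auto simp: lookup_add)
      with True show ?thesis by simp
    next
      case False
      then have "y - ?e = x \<longleftrightarrow> y = x + ?e"
        using single_1_add_minus[of y i] by (auto simp: add.commute)
      then show ?thesis by (auto simp: lookup_add)
    qed
  qed
  also have "\<dots> = of_nat (Poly_Mapping.lookup x i + 1) * Poly_Mapping.lookup f (x + ?e)"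
    by (simp add: not_in_keys_iff_lookup_eq_zero)
  finally show ?thesis .
qed

text \<open>The canonical commutation relation, the basic input for moving annihilation factors past
  creation factors.\<close>

lemma odd_deriv_odd_var_mult:
  "odd_deriv i (odd_var k * f) = odd_var k * odd_deriv i f + (if i = k then f else 0)"
proof (rule poly_mapping_eqI)
  fix x :: "nat \<Rightarrow>\<^sub>0 nat"
  let ?d = "\<lambda>i. Poly_Mapping.single i (1::nat)"
  consider "i = k" "Poly_Mapping.lookup x k \<noteq> 0" | "i = k" "Poly_Mapping.lookup x k = 0" | "i \<noteq> k"
    by blast
  then show "Poly_Mapping.lookup (odd_deriv i (odd_var k * f)) x =
    Poly_Mapping.lookup (odd_var k * odd_deriv i f + (if i = k then f else 0)) x"
  proof cases
    case 1
    then show ?thesis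
      using single_1_add_minus[of x k]
      by (simp add: lookup_odd_deriv lookup_odd_var_mult lookup_add lookup_minus of_nat_diff
          add.commute distrib_right)
  next
    case 2
    then show ?thesis by (simp add: lookup_odd_deriv lookup_odd_var_mult lookup_add)
  next
    case 3
    have "x + ?d i - ?d k = x - ?d k + ?d i" if "0 < Poly_Mapping.lookup x k"
      using 3 that
      by (intro poly_mapping_eqI) (auto simp: lookup_add lookup_minus lookup_single when_def)
    with 3 show ?thesis
      by (auto simp: lookup_odd_deriv lookup_odd_var_mult lookup_add lookup_minus lookup_single)
  qed
qed

lemma odd_deriv_scalar: "odd_deriv i (scalar c) = 0"
  by (simp add: odd_deriv_def scalar_def)

interpretation creation: commuting_ops creation_exponent
  by unfold_locales
    (auto simp: creation_exponent_def additive_def algebra_simps)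

lemma odd_deriv_0: "odd_deriv i 0 = 0"
  by (simp add: odd_deriv_def)

interpretation annihilation: commuting_ops annihilation_exponent
proof
  show "annihilation_exponent n (f + g) = annihilation_exponent n f + annihilation_exponent n g"
    for n f g
    by (auto intro!: poly_mapping_eqI
        simp: annihilation_exponent_def lookup_odd_deriv lookup_add algebra_simps)
  show "annihilation_exponent n (scalar c * f) = scalar c * annihilation_exponent n f" for n c f
    by (rule poly_mapping_eqI)
      (auto simp: annihilation_exponent_def lookup_odd_deriv lookup_scalar_mult)
  show "annihilation_exponent m (annihilation_exponent n f) =
      annihilation_exponent n (annihilation_exponent m f)" for m n f
    by (rule poly_mapping_eqI)
      (auto simp: annihilation_exponent_def odd_deriv_0 lookup_odd_deriv lookup_add
        lookup_single when_def ac_simps)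
qed (simp add: annihilation_exponent_def)

section \<open>The coefficients of \<open>Q(t)\<close> and their relations\<close>

definition power_sum :: "nat \<Rightarrow> odd_ring" where
  "power_sum n = (if odd n then odd_var (n div 2) else 0)"

lemma annihilation_exponent_power_sum_mult:
  "annihilation_exponent k (power_sum n * f) =
     power_sum n * annihilation_exponent k f - (if k = n \<and> odd n then f else 0)"
proof -
  have "k = n" if "odd k" "odd n" "k div 2 = n div 2"
    using that by (metis odd_two_times_div_two_succ)
  then show ?thesis
    by (auto simp: annihilation_exponent_def power_sum_def odd_deriv_odd_var_mult
        odd_deriv_0)
qed

text \<open>The one-row Schur Q-function, the coefficient of \<open>t^n\<close> in
  \<open>Q(t)\<close>.\<close>

definition creation_coeff :: "nat \<Rightarrow> odd_ring" where
  "creation_coeff n = ops_exp creation_exponent n 1"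

text \<open>The creation exponent consists of multiplications, so its exponential commutes with
  multiplication by \<open>f\<close> and is determined by its value at 1.\<close>

lemma ops_exp_creation: "ops_exp creation_exponent n f = creation_coeff n * f"
proof -
  have "ops_exp creation_exponent n (1 * f) = ops_exp creation_exponent n 1 * f"
    by (rule creation.ops_exp_commutes[where T = "\<lambda>g. g * f"])
      (auto simp: additive_def creation_exponent_def algebra_simps)
  then show ?thesis by (simp add: creation_coeff_def)
qed

lemma creation_coeff_0: "creation_coeff 0 = 1"
  by (simp add: creation_coeff_def creation.ops_exp_0)

text \<open>Coefficient form of \<open>t dQ/dt = 2 (p_1 t + p_3 t^3 + ...) Q\<close>;
  differentiation turns the factor \<open>2 / k\<close> of the exponent into
  \<open>2\<close>.\<close>

lemma creation_coeff_rec: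
  "of_nat n * creation_coeff n = 2 * (\<Sum>k\<le>n. power_sum k * creation_coeff (n - k))"
proof -
  have "of_nat k * creation_exponent k f = 2 * (power_sum k * f)" for k f
  proof -
    have "of_nat k * scalar (2 / of_nat k) = 2" if "odd k"
    proof -
      have "of_nat k * scalar (2 / of_nat k) = scalar (of_nat k * (2 / of_nat k))"
        by (simp only: scalar_def single_of_nat [symmetric] mult_single add_0)
      also have "of_nat k * (2 / of_nat k) = (2::complex)" using odd_pos[OF that] by simp
      finally show ?thesis by (simp add: scalar_def)
    qed
    then show ?thesis
      by (simp add: creation_exponent_def power_sum_def flip: mult.assoc)
  qed
  then show ?thesis
    unfolding creation_coeff_def creation.ops_exp_rec by (simp add: sum_distrib_left)
qed

text \<open>This is \<open>Q(-t) Q(t) = 1\<close> in positive degree. The logarithmic derivative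
  \<open>P\<close> of \<open>Q(t)\<close> is even, so that of \<open>Q(-t)\<close> is
  \<open>- P\<close> and the product is constant.\<close>

lemma creation_coeff_alternating:
  assumes "n > 0"
  shows "(\<Sum>i\<le>n. (- 1) ^ i * creation_coeff i * creation_coeff (n - i)) = 0"
proof -
  define Q where "Q = Abs_fps creation_coeff"
  \<comment> \<open>\<open>Q'\<close> is \<open>Q(-t)\<close>, not a derivative.\<close>
  define Q' where "Q' = Abs_fps (\<lambda>n. (- 1) ^ n * creation_coeff n)"
  define P where "P = Abs_fps (\<lambda>n. 2 * power_sum (Suc n))"
  have shift: "(\<Sum>k\<le>Suc n. power_sum k * g k) = (\<Sum>k\<le>n. power_sum (Suc k) * g (Suc k))" for n g
    by (subst sum.atMost_Suc_shift) (simp add: power_sum_def)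
  have Q: "fps_deriv Q = P * Q"
  proof (rule fps_ext)
    fix n
    show "fps_nth (fps_deriv Q) n = fps_nth (P * Q) n"
      using creation_coeff_rec[of "Suc n"]
      by (simp add: shift Q_def P_def fps_mult_nth atLeast0AtMost sum_distrib_left mult.assoc
          del: of_nat_Suc sum.atMost_Suc)
  qed
  have Q': "fps_deriv Q' = - P * Q'"
  proof (rule fps_ext)
    fix n
    \<comment> \<open>Evenness of \<open>P\<close>: for odd \<open>k\<close>,
      \<open>power_sum (Suc k)\<close> is zero.\<close>
    have sign: "(- 1) ^ n * power_sum (Suc k) = (- 1) ^ (n - k) * power_sum (Suc k)"
      if "k \<le> n" for k
      using that by (auto simp: power_sum_def uminus_power_if)
    have "fps_nth (fps_deriv Q') n =
        - ((- 1) ^ n * (of_nat (Suc n) * creation_coeff (Suc n)))"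
      by (simp add: Q'_def mult.left_commute del: of_nat_Suc)
    also have "\<dots> = - (\<Sum>k\<le>n. 2 * ((- 1) ^ n * power_sum (Suc k)) * creation_coeff (n - k))"
      by (simp only: creation_coeff_rec shift) (simp add: sum_distrib_left ac_simps)
    also have "\<dots> = (\<Sum>k\<le>n. - (2 * power_sum (Suc k)) * ((- 1) ^ (n - k) * creation_coeff (n - k)))"
      unfolding sum_negf [symmetric]
    proof (intro sum.cong refl)
      fix k assume "k \<in> {..n}"
      then show "- (2 * ((- 1) ^ n * power_sum (Suc k)) * creation_coeff (n - k)) =
          - (2 * power_sum (Suc k)) * ((- 1) ^ (n - k) * creation_coeff (n - k))"
        by (subst sign) (simp_all add: ac_simps)
    qed
    also have "\<dots> = fps_nth (- P * Q') n"
      by (simp add: P_def Q'_def fps_mult_nth atLeast0AtMost sum_negf)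
    finally show "fps_nth (fps_deriv Q') n = fps_nth (- P * Q') n" .
  qed
  have "fps_deriv (Q' * Q) = 0"
    by (simp add: Q Q' algebra_simps)
  then obtain c where "Q' * Q = fps_const c"
    using fps_deriv_eq_0_iff by blast
  then have "fps_nth (Q' * Q) n = 0"
    using assms by simp
  then show ?thesis
    by (simp add: Q_def Q'_def fps_mult_nth atLeast0AtMost)
qed

section \<open>Lowering operators: action on products and vanishing in large degree\<close>

abbreviation lowering :: op_series where
  "lowering \<equiv> ops_exp annihilation_exponent"

lemmas lowering_sum = additive.sum [OF annihilation.additive_ops_exp]
lemmas lowering_of_nat = additive_of_nat_mult [OF annihilation.additive_ops_exp]

text \<open>The annihilation factor is the translation of \<open>p_n\<close> to
  \<open>p_n - t^(-n)\<close> for odd \<open>n\<close>; the identity is its multiplicativity by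
  coefficients.\<close>

lemma lowering_power_sum_mult:
  "lowering b (power_sum n * f) =
     power_sum n * lowering b f - (if odd n \<and> n \<le> b then lowering (b - n) f else 0)"
proof (induction b rule: less_induct)
  case (less b)
  let ?D = annihilation_exponent
  show ?case
  proof (cases "b = 0")
    case True
    then show ?thesis by (auto simp: annihilation.ops_exp_0 elim: oddE)
  next
    case False
    have step: "?D k (lowering (b - k) (power_sum n * f)) =
        power_sum n * ?D k (lowering (b - k) f)
        - (if k = n \<and> odd n then lowering (b - n) f else 0)
        - (if odd n \<and> n \<le> b - k then ?D k (lowering (b - n - k) f) else 0)"
      if "k \<le> b" for k
    proof (cases "k = 0")
      case False
      with less that \<open>b \<noteq> 0\<close> show ?thesis
        by (auto simp: additive.diff[OF annihilation.additive]
            annihilation_exponent_power_sum_mult annihilation.zero add.commute)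
    qed (auto simp: annihilation.at_0 elim: oddE)
    \<comment> \<open>The commutator at \<open>k = n\<close> contributes weight \<open>n\<close>,
      and \<open>2\<close> contributes \<open>b - n\<close> through the recursion in degree
      \<open>b - n\<close>; together they give the weight \<open>b\<close> cancelled at the
      end.\<close>
    have 1: "(\<Sum>k\<le>b. of_nat k * (if k = n \<and> odd n then lowering (b - n) f else 0)) =
        (if odd n \<and> n \<le> b then of_nat n * lowering (b - n) f else 0)"
    proof -
      have "(\<Sum>k\<le>b. of_nat k * (if k = n \<and> odd n then lowering (b - n) f else 0)) =
          (\<Sum>k\<le>b. if k = n then (if odd n then of_nat n * lowering (b - n) f else 0) else 0)"
        by (rule sum.cong) auto
      then show ?thesis by simp
    qed
    have 2: "(\<Sum>k\<le>b. of_nat k *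
          (if odd n \<and> n \<le> b - k then ?D k (lowering (b - n - k) f) else 0)) =
        (if odd n \<and> n \<le> b then of_nat (b - n) * lowering (b - n) f else 0)"
    proof (cases "odd n \<and> n \<le> b")
      case True
      then show ?thesis
        unfolding annihilation.ops_exp_rec
        by (auto intro!: sum.mono_neutral_cong_right split: if_splits)
    qed (auto intro!: sum.neutral)
    have "of_nat b * lowering b (power_sum n * f) =
      (\<Sum>k\<le>b. of_nat k * (power_sum n * ?D k (lowering (b - k) f)))
      - (\<Sum>k\<le>b. of_nat k * (if k = n \<and> odd n then lowering (b - n) f else 0))
      - (\<Sum>k\<le>b. of_nat k *
          (if odd n \<and> n \<le> b - k then ?D k (lowering (b - n - k) f) else 0))"
      unfolding annihilation.ops_exp_rec [of b "power_sum n * f"] sum_subtractf [symmetric]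
        right_diff_distrib [symmetric]
      by (intro sum.cong refl arg_cong2 [of _ _ _ _ "(*)"] step) auto
    also have "(\<Sum>k\<le>b. of_nat k * (power_sum n * ?D k (lowering (b - k) f))) =
        of_nat b * (power_sum n * lowering b f)"
      unfolding mult.left_commute [of "of_nat _" "power_sum n"] annihilation.ops_exp_rec
        sum_distrib_left ..
    finally have "of_nat b * lowering b (power_sum n * f) = of_nat b *
        (power_sum n * lowering b f - (if odd n \<and> n \<le> b then lowering (b - n) f else 0))"
      unfolding 1 2 by (auto simp: algebra_simps of_nat_diff)
    then show ?thesis
      using False by simp
  qed
qed

lemma lowering_scalar: "b > 0 \<Longrightarrow> lowering b (scalar c) = 0"
proof (induction b rule: less_induct)
  case (less b)
  have "annihilation_exponent k (lowering (b - k) (scalar c)) = 0" if k: "k \<le> b" for k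
  proof -
    consider "k = 0" | "k = b" | "0 < k" "k < b"
      by (cases "k = 0"; cases "k = b") (use k in simp_all)
    then show ?thesis
      using less
      by cases (simp_all add: annihilation.at_0 annihilation.zero annihilation.ops_exp_0,
          simp add: annihilation_exponent_def odd_deriv_scalar)
  qed
  then have "of_nat b * lowering b (scalar c) = 0"
    unfolding annihilation.ops_exp_rec by simp
  then show ?case using less.prems by simp
qed

lemma lowering_bounded_odd_var_mult:
  assumes "\<forall>b>N. lowering b f = 0"
  shows "\<forall>b>N + (2 * i + 1). lowering b (odd_var i * f) = 0"
  using assms lowering_power_sum_mult[of _ "2 * i + 1" f] by (auto simp: power_sum_def)

text \<open>Induction on the exponent vector: each factor \<open>odd_var i\<close> raises the bound
  by \<open>2 * i + 1\<close>, the weight of the variable.\<close>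

lemma lowering_bounded_single: "\<exists>N. \<forall>b>N. lowering b (Poly_Mapping.single x c) = 0"
proof (induction x rule: update_induct)
  case const
  then show ?case
    using lowering_scalar[of _ c] by (auto simp: scalar_def)
next
  case (update x i v)
  have "\<exists>N. \<forall>b>N. lowering b (Poly_Mapping.single (Poly_Mapping.single i v + x) c) = 0" for v
  proof (induction v)
    case (Suc v)
    have "Poly_Mapping.single (Poly_Mapping.single i (Suc v) + x) c =
        odd_var i * Poly_Mapping.single (Poly_Mapping.single i v + x) c"
      by (simp add: odd_var_def mult_single flip: single_add add.assoc)
    with Suc show ?case
      using lowering_bounded_odd_var_mult by metis
  qed (use update in simp)
  moreover have "Poly_Mapping.update i v x = Poly_Mapping.single i v + x"
    using update
    by (intro poly_mapping_eqI)
      (auto simp: lookup_update lookup_add lookup_single not_in_keys_iff_lookup_eq_zero)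
  ultimately show ?case by simp
qed

lemma lowering_bounded: "\<exists>N. \<forall>b>N. lowering b f = 0"
proof -
  have *: "\<exists>N. \<forall>b>N. lowering b (\<Sum>x\<in>X. Poly_Mapping.single x (c x)) = 0"
    if "finite X" for X and c :: "(nat \<Rightarrow>\<^sub>0 nat) \<Rightarrow> complex"
    using that
  proof (induction X)
    case empty
    then show ?case using lowering_scalar[of _ 0] by (auto simp: scalar_def)
  next
    case (insert x X)
    obtain N M where "\<forall>b>N. lowering b (\<Sum>x\<in>X. Poly_Mapping.single x (c x)) = 0"
        "\<forall>b>M. lowering b (Poly_Mapping.single x (c x)) = 0"
      using insert.IH lowering_bounded_single by blast
    with insert.hyps have "\<forall>b>max N M. lowering b (\<Sum>x\<in>insert x X. Poly_Mapping.single x (c x)) = 0"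
      by (simp add: additive.add [OF annihilation.additive_ops_exp])
    then show ?case by blast
  qed
  have "f = (\<Sum>x\<in>Poly_Mapping.keys f. Poly_Mapping.single x (Poly_Mapping.lookup f x))"
    by (rule poly_mapping_eqI)
      (simp add: lookup_sum lookup_single when_def not_in_keys_iff_lookup_eq_zero)
  then show ?thesis
    using *[OF finite_keys] by metis
qed

subsection \<open>Anticommutation\<close>

text \<open>The coefficients of \<open>(1 - x) / (1 + x)\<close>.\<close>

definition exchange_coeff :: "nat \<Rightarrow> odd_ring" where
  "exchange_coeff i = (if i = 0 then 1 else 2 * (- 1) ^ i)"

text \<open>Coefficient form of \<open>x d\<kappa>/dx = - 2 x / (1 - x^2) \<kappa>\<close> for
  \<open>\<kappa> = (1 - x) / (1 + x)\<close>, where \<open>x / (1 - x^2)\<close> is the sum of the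
  odd powers of \<open>x\<close>.\<close>

lemma exchange_coeff_rec:
  "of_nat m * exchange_coeff m = - 2 * (\<Sum>k\<le>m. if odd k then exchange_coeff (m - k) else 0)"
proof (induction m rule: induct_nat_012)
  case (ge2 m)
  have "(\<Sum>k\<le>Suc (Suc m). if odd k then exchange_coeff (Suc (Suc m) - k) else 0) =
      exchange_coeff (Suc m) + (\<Sum>k\<le>m. if odd k then exchange_coeff (m - k) else 0)"
    by (simp only: sum.atMost_Suc_shift[of _ "Suc m"] sum.atMost_Suc_shift[of _ m])
      (simp cong: if_cong)
  then have "- 2 * (\<Sum>k\<le>Suc (Suc m). if odd k then exchange_coeff (Suc (Suc m) - k) else 0) =
      - 2 * exchange_coeff (Suc m) + of_nat m * exchange_coeff m"
    using ge2(1) by (simp only: distrib_left)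
  also have "\<dots> = of_nat (Suc (Suc m)) * exchange_coeff (Suc (Suc m))"
    by (auto simp: exchange_coeff_def algebra_simps)
  finally show ?case ..
qed (simp_all add: exchange_coeff_def)

text \<open>The guard gives zero in negative degree, where truncated subtraction would give
  \<open>lowering 0\<close>, the identity.\<close>

abbreviation lowering_diff :: "nat \<Rightarrow> op_series" where
  "lowering_diff b i f \<equiv> (if i \<le> b then lowering (b - i) f else 0)"

text \<open>Translating \<open>p_k\<close> by \<open>- t^(-k)\<close> multiplies \<open>Q(s)\<close>
  by \<open>exp (- 2 (x + x^3/3 + ...)) = (1 - x) / (1 + x)\<close> with \<open>x = s / t\<close>.
  The proof compares \<open>c\<close> times both sides.\<close>

lemma lowering_creation_coeff_mult:
  "lowering b (creation_coeff c * f) =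
     (\<Sum>i\<le>c. exchange_coeff i * creation_coeff (c - i) * lowering_diff b i f)"
proof (induction c arbitrary: b rule: less_induct)
  case (less c)
  let ?q = creation_coeff and ?p = power_sum and ?\<kappa> = exchange_coeff
  show ?case
  proof (cases "c = 0")
    case True
    then show ?thesis by (simp add: creation_coeff_0 exchange_coeff_def)
  next
    case False
    have 1: "?p k * lowering b (?q (c - k) * f) =
        (\<Sum>i\<le>c - k. ?\<kappa> i * (?p k * ?q (c - i - k)) * lowering_diff b i f)"
      if "k \<le> c" for k
    proof (cases "k = 0")
      case False
      with that \<open>c \<noteq> 0\<close> less[of "c - k" b] show ?thesis
        by (simp add: sum_distrib_left ac_simps cong: if_cong)
    qed (simp add: power_sum_def)
    have 2: "(if odd k then lowering_diff b k (?q (c - k) * f) else 0) =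
        (\<Sum>i\<le>c - k. (if odd k then ?\<kappa> i else 0) * ?q (c - (i + k)) * lowering_diff b (i + k) f)"
      if "k \<le> c" for k
    proof (cases "odd k \<and> k \<le> b")
      case True
      then have "c - k < c" using False odd_pos[of k] by simp
      with True less[of "c - k" "b - k"] show ?thesis
        by (auto intro!: sum.cong simp: add.commute le_diff_conv2)
    qed (auto intro!: sum.neutral)
    have "of_nat c * lowering b (?q c * f) =
        lowering b (2 * (\<Sum>k\<le>c. ?p k * (?q (c - k) * f)))"
      by (simp add: creation_coeff_rec sum_distrib_right mult.assoc flip: lowering_of_nat)
        (simp add: creation_coeff_rec sum_distrib_right mult.assoc flip: mult.assoc [of "of_nat c"])
    also have "\<dots> = 2 * (\<Sum>k\<le>c. ?p k * lowering b (?q (c - k) * f))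
        - 2 * (\<Sum>k\<le>c. if odd k then lowering_diff b k (?q (c - k) * f) else 0)"
      by (simp add: lowering_of_nat[of _ 2, simplified] lowering_sum lowering_power_sum_mult
          sum_subtractf right_diff_distrib cong: if_cong)
        (auto intro!: sum.cong)
    also have "(\<Sum>k\<le>c. ?p k * lowering b (?q (c - k) * f)) =
        (\<Sum>k\<le>c. \<Sum>i\<le>c - k. ?\<kappa> i * (?p k * ?q (c - i - k)) * lowering_diff b i f)"
      by (rule sum.cong) (simp_all only: 1 atMost_iff)
    also have "\<dots> = (\<Sum>i\<le>c. \<Sum>k\<le>c - i. ?\<kappa> i * (?p k * ?q (c - i - k)) * lowering_diff b i f)"
      by (rule sum_convolution_swap)
    \<comment> \<open>The recursion for \<open>?q\<close> yields the share \<open>c - i\<close> of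
      the weight \<open>c\<close>; below, the recursion for \<open>?\<kappa>\<close> yields the
      remaining share.\<close>
    also have "2 * \<dots> =
        (\<Sum>i\<le>c. ?\<kappa> i * (of_nat (c - i) * ?q (c - i)) * lowering_diff b i f)"
      unfolding creation_coeff_rec sum_distrib_left sum_distrib_right
      by (simp only: ac_simps)
    also have "(\<Sum>k\<le>c. if odd k then lowering_diff b k (?q (c - k) * f) else 0) =
        (\<Sum>k\<le>c. \<Sum>i\<le>c - k.
          (if odd k then ?\<kappa> i else 0) * ?q (c - (i + k)) * lowering_diff b (i + k) f)"
      by (rule sum.cong) (simp_all only: 2 atMost_iff)
    also have "\<dots> = (\<Sum>m\<le>c. \<Sum>k\<le>m.
          (if odd k then ?\<kappa> (m - k) else 0) * ?q (c - m) * lowering_diff b m f)"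
      unfolding sum_convolution_diagonal by (intro sum.cong) auto
    also have "2 * \<dots> = - (\<Sum>m\<le>c. of_nat m * ?\<kappa> m * ?q (c - m) * lowering_diff b m f)"
      unfolding exchange_coeff_rec sum_distrib_left sum_distrib_right sum_negf [symmetric]
      by (intro sum.cong refl) simp
    finally have "of_nat c * lowering b (?q c * f) =
        (\<Sum>i\<le>c. ?\<kappa> i * (of_nat (c - i) * ?q (c - i)) * lowering_diff b i f +
          of_nat i * ?\<kappa> i * ?q (c - i) * lowering_diff b i f)"
      by (simp only: sum.distrib diff_minus_eq_add)
    also have "\<dots> = of_nat c * (\<Sum>i\<le>c. ?\<kappa> i * ?q (c - i) * lowering_diff b i f)"
      unfolding sum_distrib_left
      by (intro sum.cong refl) (simp add: of_nat_diff algebra_simps)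
    finally show ?thesis using False by simp
  qed
qed

text \<open>For index \<open>- a\<close> the test in \<open>Y\<close> always succeeds, and lowering
  degree \<open>b\<close> is paired with creation degree \<open>a + b\<close>.\<close>

lemma Y_uminus_eq_sum:
  assumes "\<forall>b>N. lowering b f = 0"
  shows "Y (- int a) f = (\<Sum>b\<le>N. creation_coeff (a + b) * lowering b f)"
proof -
  have "Y (- int a) f = Sum_any (\<lambda>b. creation_coeff (a + b) * lowering b f)"
    by (simp add: Y_def ops_exp_creation nat_add_distrib add.commute
        nat_int_add flip: of_nat_add)
  also have "\<dots> = (\<Sum>b\<le>N. creation_coeff (a + b) * lowering b f)"
    using assms by (intro Sum_any.expand_superset) (auto simp: not_le [symmetric])
  finally show ?thesis .
qed

lemma additive_Y: "additive (Y (- int a))"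
proof
  fix f g
  obtain N M where "\<forall>b>N. lowering b f = 0" "\<forall>b>M. lowering b g = 0"
    using lowering_bounded by meson
  then have *: "\<forall>b>max N M. lowering b f = 0" "\<forall>b>max N M. lowering b g = 0"
    by auto
  have add: "lowering b (f + g) = lowering b f + lowering b g" for b
    by (rule additive.add [OF annihilation.additive_ops_exp])
  with * have "\<forall>b>max N M. lowering b (f + g) = 0" by simp
  with * show "Y (- int a) (f + g) = Y (- int a) f + Y (- int a) g"
    by (simp add: Y_uminus_eq_sum [where N = "max N M"] add distrib_left sum.distrib)
qed

text \<open>The Schur \<open>Q\<close>-function of a pair \<open>(x, y)\<close>.\<close>

definition pair_coeff :: "nat \<Rightarrow> nat \<Rightarrow> odd_ring" where
  "pair_coeff x y = (\<Sum>i\<le>y. exchange_coeff i * creation_coeff (y - i) * creation_coeff (x + i))"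

text \<open>Multiplied by \<open>(-1)^x\<close>, \<open>pair_coeff x y\<close> and
  \<open>pair_coeff y x\<close> become the parts \<open>r \<ge> x\<close> and
  \<open>r \<le> x\<close> of twice the alternating sum of \<open>t r\<close>, sharing the term at
  \<open>x\<close> equally. The whole sum vanishes by \<open>Q(t) Q(-t) = 1\<close>.\<close>

lemma pair_coeff_antisym:
  assumes "x + y > 0"
  shows "pair_coeff y x = - pair_coeff x y"
proof -
  define t where "t r = (- 1) ^ r * creation_coeff r * creation_coeff (x + y - r)" for r
  let ?s = "(- 1) ^ x :: odd_ring"
  \<comment> \<open>The exceptional value \<open>1\<close> at \<open>i = 0\<close> is written as
    \<open>2 - 1\<close>; this is the source of the single \<open>t x\<close> subtracted
    below.\<close>
  have \<kappa>: "exchange_coeff i = 2 * (- 1) ^ i - (if i = 0 then 1 else 0)" for i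
    by (simp add: exchange_coeff_def)
  have "?s * pair_coeff x y = (\<Sum>i\<le>y. 2 * t (x + i) - (if i = 0 then t x else 0))"
    unfolding pair_coeff_def sum_distrib_left
    by (intro sum.cong refl) (auto simp: \<kappa> t_def power_add algebra_simps)
  also have "\<dots> = 2 * (\<Sum>i\<le>y. t (x + i)) - t x"
    by (simp add: sum_subtractf sum_distrib_left)
  also have "(\<Sum>i\<le>y. t (x + i)) = (\<Sum>r=x..x + y. t r)"
    by (rule sum.reindex_bij_witness[of _ "\<lambda>r. r - x" "\<lambda>i. x + i"]) auto
  finally have 1: "?s * pair_coeff x y = 2 * (\<Sum>r=x..x + y. t r) - t x" .
  have "?s * pair_coeff y x = (\<Sum>i\<le>x. 2 * t (x - i) - (if i = 0 then t x else 0))"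
    unfolding pair_coeff_def sum_distrib_left
  proof (intro sum.cong refl)
    fix i assume "i \<in> {..x}"
    then have sign: "?s * (- 1) ^ i = (- 1) ^ (x - i)" and "x + y - (x - i) = y + i"
      by (auto simp: uminus_power_if)
    then have t: "t (x - i) = ?s * (- 1) ^ i * creation_coeff (x - i) * creation_coeff (y + i)"
      by (simp add: t_def)
    show "?s * (exchange_coeff i * creation_coeff (x - i) * creation_coeff (y + i)) =
        2 * t (x - i) - (if i = 0 then t x else 0)"
      unfolding t by (simp add: \<kappa> t_def algebra_simps)
  qed
  also have "\<dots> = 2 * (\<Sum>i\<le>x. t (x - i)) - t x"
    by (simp add: sum_subtractf sum_distrib_left)
  also have "(\<Sum>i\<le>x. t (x - i)) = (\<Sum>r\<le>x. t r)"
    by (rule sum.reindex_bij_witness[of _ "\<lambda>r. x - r" "\<lambda>i. x - i"]) auto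
  finally have 2: "?s * pair_coeff y x = 2 * (\<Sum>r\<le>x. t r) - t x" .
  have "(\<Sum>r\<le>x + y. t r) = (\<Sum>r\<le>x. t r) + (\<Sum>r=x..x + y. t r) - t x"
  proof -
    have "{..x + y} = {..x} \<union> {x..x + y}" "{..x} \<inter> {x..x + y} = {x}" by auto
    then show ?thesis by (simp add: sum_Un)
  qed
  moreover have "(\<Sum>r\<le>x + y. t r) = 0"
    unfolding t_def by (rule creation_coeff_alternating) (rule assms)
  ultimately have "?s * (pair_coeff y x + pair_coeff x y) = 0"
    unfolding distrib_left 1 2 by algebra
  then show ?thesis by (simp add: eq_neg_iff_add_eq_0)
qed

text \<open>Normal ordering: the inner creation coefficients are moved left past the outer lowering
  operators, and the products of creation coefficients collect into
  \<open>pair_coeff\<close>.\<close>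

lemma Y_Y_eq_sum:
  assumes N: "\<forall>b>N. lowering b f = 0"
  shows "Y (- int a) (Y (- int b) f) =
    (\<Sum>c\<le>N. \<Sum>d\<le>N. pair_coeff (a + c) (b + d) * lowering c (lowering d f))"
proof -
  let ?q = creation_coeff and ?\<kappa> = exchange_coeff
  \<comment> \<open>After its reduction by \<open>i \<le> b + d\<close>, with
    \<open>d \<le> N\<close>, an outer degree \<open>c > M\<close> still exceeds
    \<open>N\<close>.\<close>
  define M where "M = N + (b + N)"
  have low: "lowering c (Y (- int b) f) = (\<Sum>d\<le>N. \<Sum>i\<le>b + d.
      ?\<kappa> i * ?q (b + d - i) * lowering_diff c i (lowering d f))" for c
    unfolding Y_uminus_eq_sum [OF N] lowering_sum lowering_creation_coeff_mult ..
  \<comment> \<open>Lowering operators commute, so the one of large degree may act first.\<close>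
  have zero: "lowering c (lowering d f) = 0" if "c > N" for c d
    using that N annihilation.ops_exp_ops_exp_commute[of c d f]
    by (simp add: additive.zero [OF annihilation.additive_ops_exp])
  \<comment> \<open>Replacing \<open>c\<close> by \<open>c + i\<close> moves the shift from the
    lowering degree to the creation index.\<close>
  have shift: "(\<Sum>c\<le>M. ?q (a + c) * lowering_diff c i g) =
      (\<Sum>c\<le>N. ?q (a + c + i) * lowering c g)"
    if g: "g = lowering d f" and i: "i \<le> b + d" "d \<le> N" for g d i
  proof -
    have "(\<Sum>c\<le>M. ?q (a + c) * lowering_diff c i g) =
        (\<Sum>c=i..N + i. ?q (a + c) * lowering_diff c i g)"
      using i by (intro sum.mono_neutral_right) (auto simp: M_def g zero)
    also have "\<dots> = (\<Sum>c\<le>N. ?q (a + c + i) * lowering c g)"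
      by (rule sum.reindex_bij_witness[of _ "\<lambda>c. c + i" "\<lambda>c. c - i"]) auto
    finally show ?thesis .
  qed
  have "lowering c (Y (- int b) f) = 0" if "c > M" for c
    using that unfolding low by (intro sum.neutral ballI) (auto simp: M_def zero)
  then have "Y (- int a) (Y (- int b) f) = (\<Sum>c\<le>M. ?q (a + c) * lowering c (Y (- int b) f))"
    by (intro Y_uminus_eq_sum) auto
  also have "\<dots> = (\<Sum>c\<le>M. \<Sum>d\<le>N. \<Sum>i\<le>b + d.
      ?\<kappa> i * ?q (b + d - i) * (?q (a + c) * lowering_diff c i (lowering d f)))"
    unfolding low sum_distrib_left by (intro sum.cong refl) (simp only: ac_simps)
  also have "\<dots> = (\<Sum>d\<le>N. \<Sum>i\<le>b + d. \<Sum>c\<le>M.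
      ?\<kappa> i * ?q (b + d - i) * (?q (a + c) * lowering_diff c i (lowering d f)))"
    by (subst sum.swap) (intro sum.cong refl sum.swap)
  also have "\<dots> = (\<Sum>d\<le>N. \<Sum>i\<le>b + d. \<Sum>c\<le>N.
      ?\<kappa> i * ?q (b + d - i) * (?q (a + c + i) * lowering c (lowering d f)))"
    unfolding sum_distrib_left [symmetric]
    by (intro sum.cong refl arg_cong2 [of _ _ _ _ "(*)"] shift) auto
  also have "\<dots> = (\<Sum>d\<le>N. \<Sum>c\<le>N. pair_coeff (a + c) (b + d) * lowering c (lowering d f))"
    unfolding pair_coeff_def sum_distrib_right mult.assoc
    by (intro sum.cong refl sum.swap)
  also have "\<dots> = (\<Sum>c\<le>N. \<Sum>d\<le>N. pair_coeff (a + c) (b + d) * lowering c (lowering d f))"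
    by (rule sum.swap)
  finally show ?thesis .
qed

text \<open>Lowering operators commute, so exchanging the two summation indices reduces the claim to
  the antisymmetry of \<open>pair_coeff\<close>.\<close>

lemma Y_anticommute:
  assumes "a + b > 0"
  shows "Y (- int a) (Y (- int b) f) = - Y (- int b) (Y (- int a) f)"
proof -
  obtain N where N: "\<forall>b>N. lowering b f = 0"
    using lowering_bounded by blast
  have "pair_coeff (a + c) (b + d) * lowering c (lowering d f) =
      - (pair_coeff (b + d) (a + c) * lowering d (lowering c f))" for c d
  proof -
    have "b + d + (a + c) > 0" using assms by auto
    from pair_coeff_antisym[OF this] annihilation.ops_exp_ops_exp_commute[of c d f]
    show ?thesis by simp
  qed
  then show ?thesis
    unfolding Y_Y_eq_sum [OF N] by (subst sum.swap) (simp add: sum_negf)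
qed

lemma Y_Y_eq_0:
  assumes "a > 0"
  shows "Y (- int a) (Y (- int a) f) = 0"
  using Y_anticommute[of a a f] assms by simp

section \<open>Signs in products of the operators \<open>Y\<close>\<close>

lemma Y_product_Nil: "Y_product [] = id"
  by (simp add: Y_product_def)

lemma Y_product_Cons: "Y_product (a # xs) f = Y (- int a) (Y_product xs f)"
  by (simp add: Y_product_def)

lemma Y_product_append: "Y_product (xs @ ys) f = Y_product xs (Y_product ys f)"
  by (induction xs) (simp_all add: Y_product_Nil Y_product_Cons)

lemma additive_Y_product: "additive (Y_product xs)"
  by (induction xs)
    (simp_all add: additive_def Y_product_Nil Y_product_Cons additive.add [OF additive_Y])

lemma Y_product_sign: "Y_product xs ((- 1) ^ n * f) = (- 1) ^ n * Y_product xs f"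
  by (cases "even n") (simp_all add: additive.minus [OF additive_Y_product])

lemma Y_Y_product:
  assumes "a > 0"
  shows "Y (- int a) (Y_product xs f) = (- 1) ^ length xs * Y_product xs (Y (- int a) f)"
proof (induction xs)
  case (Cons x xs)
  have "Y (- int a) (Y_product (x # xs) f) = - Y (- int x) (Y (- int a) (Y_product xs f))"
    unfolding Y_product_Cons using assms by (intro Y_anticommute) simp
  also have "\<dots> = - Y_product [x] ((- 1) ^ length xs * Y_product xs (Y (- int a) f))"
    by (simp add: Cons.IH Y_product_Cons Y_product_Nil)
  finally show ?case
    unfolding Y_product_sign by (simp add: Y_product_Cons Y_product_Nil)
qed (simp add: Y_product_Nil)

subsection \<open>Codes\<close>

lemma boundary_steps_append:
  "boundary_steps a (xs @ ys) = boundary_steps a xs @ boundary_steps (last (a # xs)) ys"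
  by (induction xs arbitrary: a) auto

lemma U_notin_H: "U \<notin> set (H a b)"
  by (simp add: H_def)

lemma H_append: "a \<le> b \<Longrightarrow> b \<le> c \<Longrightarrow> H a b @ H b c = H a c"
  by (simp add: H_def flip: replicate_add)

lemma append_U_cancel:
  "xs @ U # ys = xs' @ U # ys' \<Longrightarrow> U \<notin> set xs \<Longrightarrow> U \<notin> set xs' \<Longrightarrow> xs = xs' \<and> ys = ys'"
  by (induction xs arbitrary: xs') (auto simp: Cons_eq_append_conv append_eq_Cons_conv)

text \<open>Blocks \<open>H\<close> contain no \<open>U\<close>, so every \<open>U\<close> ends a
  row and cutting behind it splits the list of rows.\<close>

lemma boundary_steps_split:
  assumes "boundary_steps a xs = B @ U # C"
  shows "\<exists>ys zs. xs = ys @ zs \<and> ys \<noteq> [] \<and> boundary_steps a ys = B @ [U] \<and>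
    boundary_steps (last ys) zs = C"
  using assms
proof (induction xs arbitrary: a B)
  case (Cons b bs)
  show ?case
  proof (cases "U \<in> set B")
    case False
    then have "H a b = B \<and> boundary_steps b bs = C"
      using Cons.prems by (intro append_U_cancel) (simp_all add: U_notin_H)
    then show ?thesis by (intro exI[of _ "[b]"] exI[of _ bs]) simp
  next
    case True
    then obtain B1 B2 where B: "B = B1 @ U # B2" "U \<notin> set B1"
      using split_list_first by metis
    then have "H a b = B1 \<and> boundary_steps b bs = B2 @ U # C"
      using Cons.prems by (intro append_U_cancel) (simp_all add: U_notin_H)
    then obtain ys zs where "bs = ys @ zs" "ys \<noteq> []" "boundary_steps b ys = B2 @ [U]"
        "boundary_steps (last ys) zs = C" "H a b = B1"
      using Cons.IH by blast
    then show ?thesis using B by (intro exI[of _ "b # ys"] exI[of _ zs]) simp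
  qed
qed simp

lemma sorted_if_L_notin_boundary_steps:
  "L \<notin> set (boundary_steps a ys) \<Longrightarrow> sorted (a # ys)"
proof (induction ys arbitrary: a)
  case (Cons b bs)
  then have "a \<le> b" by (auto simp: H_def split: if_splits)
  moreover have "sorted (b # bs)" using Cons.IH[of b] Cons.prems by simp
  ultimately show ?case by auto
qed simp

text \<open>A weakly increasing path has one \<open>U\<close> per row, and its letters
  \<open>R\<close> add up to the total increase. This later gives the \<open>k\<close> letters
  \<open>R\<close> and the length \<open>k + j\<close> of the segment.\<close>

lemma sorted_boundary_steps:
  assumes "sorted (a # ys)"
  shows "a \<le> last (a # ys)"
    and "length (boundary_steps a ys) = (last (a # ys) - a) + length ys"
    and "count_list (boundary_steps a ys) R = last (a # ys) - a"
proof -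
  have "a \<le> last (a # ys) \<and>
    length (boundary_steps a ys) = (last (a # ys) - a) + length ys \<and>
    count_list (boundary_steps a ys) R = last (a # ys) - a"
    using assms
  proof (induction ys arbitrary: a)
    case (Cons b bs)
    have "count_list (H a b) R = b - a" "length (H a b) = b - a"
      using Cons.prems by (simp_all add: H_def count_list_eq_length_filter)
    moreover have "b \<le> last (b # bs)" "a \<le> b" using Cons by auto
    ultimately show ?case
      using Cons.IH[of b] Cons.prems by auto
  qed simp
  then show "a \<le> last (a # ys)"
    and "length (boundary_steps a ys) = (last (a # ys) - a) + length ys"
    and "count_list (boundary_steps a ys) R = last (a # ys) - a"
    by blast+
qed

lemma boundary_steps_eq_Nil_iff: "boundary_steps a xs = [] \<longleftrightarrow> xs = []"
  by (cases xs) simp_all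

lemma last_boundary_steps: "boundary_steps a xs \<noteq> [] \<Longrightarrow> last (boundary_steps a xs) = U"
  by (induction xs arbitrary: a) auto

section \<open>Locating \<open>L^k U\<close> in a code\<close>

lemma segment_eq_drop:
  assumes "\<And>i. 1 \<le> i \<Longrightarrow> i \<le> length B \<Longrightarrow> \<beta> i = B ! (length B - i)" "n \<le> length B"
  shows "segment \<beta> n = drop (length B - n) B"
proof (rule nth_equalityI)
  have len: "length (segment \<beta> n) = n" by (simp add: segment_def)
  then show "length (segment \<beta> n) = length (drop (length B - n) B)"
    using assms(2) by simp
  fix i
  assume "i < length (segment \<beta> n)"
  then have i: "i < n" by (simp add: len)
  then have "segment \<beta> n ! i = \<beta> (n - i)"
    using i by (simp add: segment_def rev_nth Suc_diff_Suc del: upt_Suc)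
  also have "\<dots> = B ! (length B - (n - i))"
    using i assms by simp
  also have "length B - (n - i) = length B - n + i"
    using i assms(2) by simp
  finally show "segment \<beta> n ! i = drop (length B - n) B ! i"
    using assms(2) by simp
qed

lemma biword_eq_shift:
  assumes "\<And>i. i \<ge> 1 \<Longrightarrow> \<beta> i = (if i \<le> length B then B ! (length B - i) else U)"
    and "\<And>n. \<gamma> (n + 1) = (if n < length G then G ! n else R)"
  shows "biword \<beta> xs \<gamma> = (\<lambda>n. biword (\<lambda>_. U) (B @ xs @ G) (\<lambda>_. R) (n + int (length B)))"
proof
  fix n :: int
  consider "n < 0" | i where "n = int i" "i < length xs" | i where "n = int (length xs + i)"
    by (metis add_diff_inverse_nat int_nat_eq not_less nat_int)
  then show "biword \<beta> xs \<gamma> n = biword (\<lambda>_. U) (B @ xs @ G) (\<lambda>_. R) (n + int (length B))"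
  proof cases
    case 1
    then obtain i where i: "n = - int i" "i \<ge> 1"
      by (metis add.inverse_inverse neg_0_less_iff_less of_nat_0_less_iff pos_int_cases
          Suc_leI One_nat_def)
    show ?thesis
    proof (cases "i \<le> length B")
      case True
      then have "nat (n + int (length B)) = length B - i" "length B - i < length B"
        using i by simp_all
      with True i show ?thesis by (simp add: biword_def assms(1) nth_append)
    next
      case False
      with i show ?thesis by (simp add: biword_def assms(1))
    qed
  next
    case 2
    then show ?thesis by (simp add: biword_def nth_append flip: of_nat_add)
  next
    case 3
    have "nat (n + int (length B)) = length B + (length xs + i)" using 3 by simp
    with 3 show ?thesis by (simp add: biword_def nth_append nat_int_add assms(2) [simplified])
  qed
qed

text \<open>The letters of \<open>L^k U\<close> cannot lie in the constant tails, so the offset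
  places them in the finite boundary word. As \<open>\<beta> 1 = U\<close>, the \<open>L^k\<close>
  is a complete block \<open>H\<close>, and cutting before it separates the lower rows
  \<open>ys\<close> from the shorter row \<open>z\<close>.\<close>

lemma code_decompose:
  assumes pos: "\<forall>a\<in>set \<mu>. 0 < a" and k: "k \<ge> 1"
    and \<beta>: "\<forall>i\<ge>1. \<beta> i \<in> {R, U}" "\<beta> 1 = U"
    and same: "same_word (code \<mu>) (biword \<beta> (replicate k L @ [U]) \<gamma>)"
  obtains ys z zs where "rev \<mu> = ys @ z # zs" "ys \<noteq> []" "sorted (0 # ys)" "last ys = z + k"
    "\<And>i. i \<ge> 1 \<Longrightarrow> \<beta> i = (if i \<le> length (boundary_steps 0 ys)
       then boundary_steps 0 ys ! (length (boundary_steps 0 ys) - i) else U)"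
    "\<And>n. \<gamma> (n + 1) = (if n < length (boundary_steps z zs) then boundary_steps z zs ! n else R)"
proof -
  define bs where "bs = boundary_steps 0 (rev \<mu>)"
  let ?w = "biword \<beta> (replicate k L @ [U]) \<gamma>"
  have code: "code \<mu> n = (if n < 0 then U else if n < int (length bs) then bs ! nat n else R)" for n
    by (simp add: code_def biword_def bs_def)
  obtain s where "\<forall>n. code \<mu> n = ?w (n + s)"
    using same by (auto simp: same_word_def)
  then have w: "?w n = code \<mu> (n - s)" for n
    by simp
  have "code \<mu> (- s) = L"
    using w[of 0] k by (simp add: biword_def nth_append)
  then have s: "0 \<le> - s" "- s < int (length bs)" by (auto simp: code split: if_splits)
  define p where "p = nat (- s)"
  have sp: "s = - int p" and p: "p < length bs" using s by (simp_all add: p_def)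
  have left: "\<beta> i = (if i \<le> p then bs ! (p - i) else U)" if "i \<ge> 1" for i
  proof -
    have "\<beta> i = code \<mu> (int p - int i)"
      using w[of "- int i"] that by (simp add: biword_def sp)
    then show ?thesis
      using p by (auto simp: code nat_diff_distrib)
  qed
  have mid: "bs ! (p + i) = (replicate k L @ [U]) ! i \<and> p + i < length bs" if "i \<le> k" for i
  proof -
    have "(replicate k L @ [U]) ! i = code \<mu> (int (p + i))"
      using w[of "int i"] that by (simp add: biword_def sp add.commute)
    moreover have "(replicate k L @ [U]) ! i \<noteq> R"
      using that by (simp add: nth_append)
    ultimately show ?thesis
      by (auto simp: code simp del: of_nat_add split: if_splits)
  qed
  have right: "\<gamma> (n + 1) = (if p + k + 1 + n < length bs then bs ! (p + k + 1 + n) else R)" for n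
  proof -
    have "\<gamma> (n + 1) = code \<mu> (int (p + k + 1 + n))"
      using w[of "int (k + 1 + n)"] by (simp add: biword_def sp ac_simps nat_add_distrib)
    then show ?thesis
      unfolding code by (simp only: nat_int of_nat_less_iff of_nat_less_0_iff if_False)
  qed
  \<comment> \<open>Rows are positive, so the boundary word begins with \<open>R\<close>, not
    \<open>L\<close>; hence the \<open>U\<close> before \<open>L^k\<close> ends a row instead of
    belonging to the left tail.\<close>
  have "p \<noteq> 0"
  proof
    assume "p = 0"
    then have "bs ! 0 = L" using mid[of 0] k by (simp add: nth_append)
    moreover have "bs ! 0 = R"
    proof (cases "rev \<mu>")
      case (Cons b _)
      then have "b > 0" using pos by (metis list.set_intros(1) set_rev)
      then show ?thesis by (simp add: bs_def Cons H_def nth_append)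
    qed (use p in \<open>simp add: bs_def\<close>)
    ultimately show False by simp
  qed
  then have "take p bs = take (p - 1) bs @ [U]"
    using left[of 1] \<beta>(2) p by (metis One_nat_def Suc_pred' Suc_le_eq le_refl
        less_imp_diff_less not_gr_zero take_Suc_conv_app_nth)
  moreover have "take (k + 1) (drop p bs) = replicate k L @ [U]"
  proof (rule nth_equalityI)
    show "length (take (k + 1) (drop p bs)) = length (replicate k L @ [U])"
    proof -
      have "p + k < length bs" using mid[of k] by simp
      then have "Suc k \<le> length bs - p" by arith
      then show ?thesis by (simp add: min_absorb2)
    qed
    then show "take (k + 1) (drop p bs) ! i = (replicate k L @ [U]) ! i"
      if "i < length (take (k + 1) (drop p bs))" for i
      using that mid[of i] by (simp add: less_Suc_eq_le)
  qed
  moreover have "bs = take p bs @ take (k + 1) (drop p bs) @ drop (p + k + 1) bs"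
    by (metis append_take_drop_id drop_drop add.commute add.left_commute)
  ultimately have "bs = take (p - 1) bs @ U # (replicate k L @ U # drop (p + k + 1) bs)"
    by simp
  from boundary_steps_split[OF trans[OF bs_def[symmetric] this]]
  obtain ys zs' where ys: "rev \<mu> = ys @ zs'" "ys \<noteq> []"
      "boundary_steps 0 ys = take (p - 1) bs @ [U]"
      "boundary_steps (last ys) zs' = replicate k L @ U # drop (p + k + 1) bs"
    by blast
  have B: "boundary_steps 0 ys = take p bs"
    using ys(3) \<open>take p bs = take (p - 1) bs @ [U]\<close> by simp
  obtain z zs where zs: "zs' = z # zs"
    using ys(4) by (cases zs') auto
  have "H (last ys) z = replicate k L \<and> boundary_steps z zs = drop (p + k + 1) bs"
    using ys(4) zs by (intro append_U_cancel) (simp_all add: U_notin_H)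
  then have G: "boundary_steps z zs = drop (p + k + 1) bs" and "H (last ys) z = replicate k L"
    by simp_all
  \<comment> \<open>Since \<open>k \<ge> 1\<close>, the branch of \<open>H\<close> with letters
    \<open>R\<close> is impossible.\<close>
  then have "last ys = z + k"
    using k by (auto simp: H_def split: if_splits)
  moreover have "L \<notin> set (boundary_steps 0 ys)"
  proof
    assume "L \<in> set (boundary_steps 0 ys)"
    then obtain i where "i < p" "bs ! i = L"
      using p by (auto simp: B in_set_conv_nth)
    then have "\<beta> (p - i) = L" using left[of "p - i"] by simp
    with \<beta>(1) \<open>i < p\<close> show False by (metis letter.distinct(1,5) Suc_leI One_nat_def insertE
          singletonD zero_less_diff)
  qed
  then have "sorted (0 # ys)" by (rule sorted_if_L_notin_boundary_steps)
  moreover have "\<beta> i = (if i \<le> length (boundary_steps 0 ys)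
      then boundary_steps 0 ys ! (length (boundary_steps 0 ys) - i) else U)" if "i \<ge> 1" for i
    using left[OF that] p that by (simp add: B)
  moreover have "\<gamma> (n + 1) =
      (if n < length (boundary_steps z zs) then boundary_steps z zs ! n else R)" for n
    unfolding right G by (simp add: less_diff_conv ac_simps)
  moreover have "rev \<mu> = ys @ z # zs"
    using ys(1) zs by simp
  ultimately show thesis
    using that ys(2) by blast
qed

section \<open>Reduction of words\<close>

lemma deletes_LR: "deletes (biword \<beta> (xs @ L # R # ys) \<gamma>) (biword \<beta> (xs @ ys) \<gamma>)"
proof -
  have "cancels_at (biword \<beta> (xs @ L # R # ys) \<gamma>) (int (length xs))"
    by (simp add: cancels_at_def biword_def nth_append nat_add_distrib)
  moreover have "biword \<beta> (xs @ ys) \<gamma> n =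
      delete_pair (biword \<beta> (xs @ L # R # ys) \<gamma>) (int (length xs)) n" for n
  proof (cases "n < int (length xs)")
    case True
    then show ?thesis by (simp add: delete_pair_def biword_def nth_append nat_less_iff)
  next
    case False
    then obtain i where "n = int (length xs + i)"
      by (metis not_less zle_iff_zadd of_nat_add)
    then have "n = int (length xs + i)" "nat (n + 2) = length xs + (i + 2)" by simp_all
    then show ?thesis by (simp add: delete_pair_def biword_def nth_append nat_int_add)
  qed
  ultimately show ?thesis unfolding deletes_def by blast
qed

lemma deletes_replicate_LR:
  "deletes\<^sup>*\<^sup>* (biword \<beta> (xs @ replicate n L @ replicate n R @ ys) \<gamma>) (biword \<beta> (xs @ ys) \<gamma>)"
proof (induction n)
  case (Suc n)
  have "xs @ replicate (Suc n) L @ replicate (Suc n) R @ ys =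
      (xs @ replicate n L) @ L # R # (replicate n R @ ys)"
    by (simp add: replicate_app_Cons_same)
  then have "deletes (biword \<beta> (xs @ replicate (Suc n) L @ replicate (Suc n) R @ ys) \<gamma>)
      (biword \<beta> (xs @ replicate n L @ replicate n R @ ys) \<gamma>)"
    using deletes_LR[of \<beta> "xs @ replicate n L" "replicate n R @ ys" \<gamma>] by simp
  then show ?case using Suc.IH by (rule converse_rtranclp_into_rtranclp)
qed simp

lemma biword_replicate_R: "biword \<beta> (xs @ replicate n R) (\<lambda>_. R) = biword \<beta> xs (\<lambda>_. R)"
  by (rule ext) (auto simp: biword_def nth_append)

text \<open>Only the block directly after \<open>L^k\<close> interacts with it; once the pairs are
  deleted, that block starts from \<open>z + k\<close> instead of \<open>z\<close>.\<close>

lemma deletes_boundary_steps: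
  "deletes\<^sup>*\<^sup>* (biword \<beta> (xs @ replicate k L @ boundary_steps z zs) (\<lambda>_. R))
     (biword \<beta> (xs @ boundary_steps (z + k) zs) (\<lambda>_. R))"
proof (cases zs)
  case Nil
  \<comment> \<open>The \<open>k\<close> letters \<open>R\<close> that cancel \<open>L^k\<close> are
    taken from the right tail.\<close>
  then show ?thesis
    using deletes_replicate_LR[of \<beta> xs k "[]" "\<lambda>_. R"] biword_replicate_R[of \<beta> "xs @ replicate k L" k]
    by simp
next
  case (Cons b bs)
  \<comment> \<open>In these cases none, all, or exactly \<open>d\<close> of the letters
    \<open>L\<close> cancel.\<close>
  consider "b \<le> z" | d where "b = z + k + d" | d e where "b = z + d" "k = d + e"
    by (metis le_Suc_ex add.assoc nat_le_linear)
  then show ?thesis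
  proof cases
    case 1
    then have "replicate k L @ H z b = H (z + k) b"
      by (cases "z = b") (simp_all add: H_def flip: replicate_add)
    then show ?thesis by (simp add: Cons flip: append_assoc)
  next
    case 2
    then show ?thesis
      using deletes_replicate_LR[of \<beta> xs k "replicate d R @ U # boundary_steps b bs" "\<lambda>_. R"]
      by (simp add: Cons H_def replicate_add)
  next
    case 3
    then show ?thesis
      using deletes_replicate_LR[of \<beta> "xs @ replicate e L" d "U # boundary_steps b bs" "\<lambda>_. R"]
      by (cases "e = 0") (simp_all add: Cons H_def replicate_add add.commute[of d e])
  qed
qed

lemma boundary_steps_no_cancellation:
  "successively (\<lambda>x y. \<not> (x = L \<and> y = R \<or> x = R \<and> y = L)) (boundary_steps a xs)"
proof (induction xs arbitrary: a)
  case (Cons b bs)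
  have rep: "successively P (replicate n x)" if "P x x" for P n and x :: letter
    using that by (induction n rule: induct_nat_012) auto
  show ?case
    using Cons by (auto simp: successively_append_iff H_def rep successively_Cons)
qed simp

text \<open>Each block \<open>H\<close> has a single direction and ends at a \<open>U\<close>; the
  last \<open>U\<close> also separates the finite part from the tail of \<open>R\<close>.\<close>

lemma reduced_code: "reduced (code \<mu>)"
  unfolding reduced_def
proof
  fix i
  define bs where "bs = boundary_steps 0 (rev \<mu>)"
  have code: "code \<mu> n = (if n < 0 then U else if n < int (length bs) then bs ! nat n else R)" for n
    by (simp add: code_def biword_def bs_def)
  consider "i < 0" | j where "i = int j" "Suc j < length bs" | j where "i = int j" "Suc j = length bs"
    | j where "i = int j" "length bs \<le> j"
    by (metis not_less nat_int int_nat_eq Suc_lessI)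
  then show "\<not> cancels_at (code \<mu>) i"
  proof cases
    case 2
    then have "nat (i + 1) = Suc j" by simp
    with 2 show ?thesis
      using boundary_steps_no_cancellation[of 0 "rev \<mu>"]
      by (auto simp: cancels_at_def code successively_conv_nth bs_def)
  next
    case 3
    then have "bs ! j = U"
      using last_boundary_steps[of 0 "rev \<mu>"] by (metis bs_def diff_Suc_1 last_conv_nth
          length_0_conv nat.distinct(1))
    with 3 show ?thesis by (simp add: cancels_at_def code)
  qed (simp_all add: cancels_at_def code)
qed

lemma is_reduced_form_shift:
  assumes "is_reduced_form v w"
  shows "is_reduced_form (\<lambda>n. v (n + s)) (\<lambda>n. w (n + s))"
proof -
  have step: "deletes (\<lambda>n. v (n + s)) (\<lambda>n. w (n + s))" if vw: "deletes v w" for v w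
  proof -
    obtain i where i: "cancels_at v i" "w = delete_pair v i"
      using vw by (auto simp: deletes_def)
    have "cancels_at (\<lambda>n. v (n + s)) (i - s)"
      using i(1) by (simp add: cancels_at_def)
    moreover have "(\<lambda>n. w (n + s)) = delete_pair (\<lambda>n. v (n + s)) (i - s)"
      by (auto simp: i(2) delete_pair_def ac_simps)
    ultimately show ?thesis unfolding deletes_def by blast
  qed
  have "deletes\<^sup>*\<^sup>* v w" using assms by (simp add: is_reduced_form_def)
  then have "deletes\<^sup>*\<^sup>* (\<lambda>n. v (n + s)) (\<lambda>n. w (n + s))"
    by (induction rule: rtranclp_induct) (auto intro: step rtranclp.rtrancl_into_rtrancl)
  moreover have "reduced (\<lambda>n. w (n + s))"
    using assms by (auto simp: is_reduced_form_def reduced_def cancels_at_def ac_simps)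
  ultimately show ?thesis by (simp add: is_reduced_form_def)
qed

theorem theorem6p3:
  fixes \<mu> :: "nat list" and m k :: nat and \<beta> \<gamma> :: "nat \<Rightarrow> letter"
  assumes "composition_of m \<mu>"
    and "k \<ge> 1"
    and "\<forall>i\<ge>1. \<beta> i \<in> {R, U}"
    and "\<beta> 1 = U"
    and "same_word (code \<mu>) (biword \<beta> (replicate k L @ [U]) \<gamma>)"
  shows "\<exists>j::nat.
    count_list (segment \<beta> (k + j)) R = k \<and>
    (\<forall>i. count_list (segment \<beta> (k + i)) R = k \<longrightarrow> j \<le> i) \<and>
    (\<beta> (k + j + 1) = U \<longrightarrow> Y_product \<mu> = (\<lambda>f. 0)) \<and>
    (\<beta> (k + j + 1) = R \<longrightarrow>
      (\<exists>\<nu> w. composition_of m \<nu> \<and> length \<nu> = length \<mu> \<and>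
        is_reduced_form
          (biword (\<lambda>i. \<beta> (k + j + i)) ([U] @ segment \<beta> (k + j) @ replicate k L) \<gamma>) w \<and>
        same_word w (code \<nu>) \<and>
        Y_product \<mu> = (\<lambda>f. (- 1) ^ j * Y_product \<nu> f)))"
proof -
  have pos: "\<forall>a\<in>set \<mu>. 0 < a" using assms(1) by (simp add: composition_of_def)
  obtain ys z zs where \<mu>: "rev \<mu> = ys @ z # zs" and ys: "ys \<noteq> []" "sorted (0 # ys)"
    and z: "last ys = z + k"
    and \<beta>: "\<And>i. i \<ge> 1 \<Longrightarrow> \<beta> i = (if i \<le> length (boundary_steps 0 ys)
       then boundary_steps 0 ys ! (length (boundary_steps 0 ys) - i) else U)"
    and \<gamma>: "\<And>n. \<gamma> (n + 1) =
      (if n < length (boundary_steps z zs) then boundary_steps z zs ! n else R)"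
    using code_decompose[OF pos assms(2-5)] by metis
  have z_pos: "z > 0" using pos \<mu> by (metis in_set_conv_decomp set_rev)
  \<comment> \<open>The rows \<open>ys\<close> weakly increase upwards, so this separates those of
    length at most \<open>z\<close> from the longer ones, whose number is \<open>j\<close>.\<close>
  define us where "us = takeWhile (\<lambda>y. y \<le> z) ys"
  define vs where "vs = dropWhile (\<lambda>y. y \<le> z) ys"
  have ys_eq: "ys = us @ vs" by (simp add: us_def vs_def)
  have "vs \<noteq> []"
    using ys(1) z assms(2) last_in_set[of ys] unfolding vs_def dropWhile_eq_Nil_conv by force
  then obtain v vs' where vs: "vs = v # vs'" by (cases vs) auto
  have v: "z < v" using vs hd_dropWhile[of "\<lambda>y. y \<le> z" ys] \<open>vs \<noteq> []\<close> by (simp add: vs_def)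
  define u where "u = last (0 # us)"
  have u: "u \<le> z"
    by (auto simp: u_def us_def dest: set_takeWhileD last_in_set)
  \<comment> \<open>The path is cut where it reaches length \<open>z\<close>, inside the block from
    \<open>u\<close> to \<open>v\<close>; \<open>B2\<close> will be the segment of length
    \<open>k + j\<close>.\<close>
  define B1 where "B1 = boundary_steps 0 us @ H u z"
  define B2 where "B2 = boundary_steps z vs"
  have B: "boundary_steps 0 ys = B1 @ B2"
    using u v unfolding ys_eq vs boundary_steps_append B1_def B2_def u_def [symmetric]
    by (simp add: H_append flip: append_assoc) (simp add: H_append [of u z v, symmetric])
  have us_z: "boundary_steps 0 (us @ [z]) = B1 @ [U]"
    unfolding boundary_steps_append B1_def u_def [symmetric] by simp
  have last_vs: "last vs = z + k" using z ys_eq \<open>vs \<noteq> []\<close> by simp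
  have "sorted (z # vs)" using ys(2) v by (auto simp: ys_eq vs sorted_append)
  note B2_props = sorted_boundary_steps[OF this, folded B2_def]
  define j where "j = length vs"
  have len: "length B2 = k + j" and count: "count_list B2 R = k"
    using B2_props last_vs \<open>vs \<noteq> []\<close> by (simp_all add: j_def)
  \<comment> \<open>Minimality of \<open>j\<close>: since \<open>v > z\<close>, \<open>B2\<close>
    starts with \<open>R\<close>, and every shorter segment omits this letter.\<close>
  obtain B2' where B2': "B2 = R # B2'"
    using v by (cases "v - z") (auto simp: B2_def vs H_def)
  have seg: "segment \<beta> n = drop (length B2 - n) B2" if "n \<le> length B2" for n
    using segment_eq_drop[of "B1 @ B2" \<beta> n] \<beta> that by (simp add: B)
  have seg_j: "segment \<beta> (k + j) = B2" using seg[of "k + j"] len by simp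
  have "j \<le> i" if i: "count_list (segment \<beta> (k + i)) R = k" for i
  proof (rule ccontr)
    assume "\<not> j \<le> i"
    then have "segment \<beta> (k + i) = drop (j - i - 1) B2'"
      using seg[of "k + i"] len B2' by (simp add: drop_Cons')
    moreover have "count_list (drop n B2') R \<le> count_list B2' R" for n
      by (metis append_take_drop_id count_list_append le_add2)
    ultimately show False
      using i count B2' by (metis Suc_n_not_le_n count_list.simps(2) Suc_eq_plus1)
  qed
  moreover have next_letter: "\<beta> (k + j + 1) = last B1" and "B1 \<noteq> []"
  proof -
    show "B1 \<noteq> []"
      using z_pos u by (auto simp: B1_def H_def u_def boundary_steps_eq_Nil_iff)
    then show "\<beta> (k + j + 1) = last B1"
      using \<beta>[of "k + j + 1"] by (cases B1 rule: rev_cases) (simp_all add: B len nth_append)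
  qed
  have \<mu>_eq: "\<mu> = rev zs @ z # rev vs @ rev us"
    using \<mu> ys_eq by (metis rev_append rev_rev_ident rev.simps(2) append_assoc append.simps)
  have swap: "Y_product \<mu> f =
      (- 1) ^ j * Y_product (rev zs) (Y_product (rev vs) (Y (- int z) (Y_product (rev us) f)))" for f
    by (simp add: \<mu>_eq Y_product_append Y_product_Cons Y_Y_product[OF z_pos] Y_product_sign j_def)
  have "Y_product \<mu> = (\<lambda>f. 0)" if "\<beta> (k + j + 1) = U"
  proof -
    \<comment> \<open>Otherwise \<open>H u z\<close> is nonempty and \<open>B1\<close> ends with
      \<open>R\<close>.\<close>
    have "u = z"
      using that u unfolding next_letter by (cases "u = z") (auto simp: B1_def H_def)
    \<comment> \<open>As \<open>z > 0\<close>, \<open>u\<close> is not the default \<open>0\<close>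
      of an empty \<open>us\<close>, so the row just below \<open>vs\<close> also has length
      \<open>z\<close>.\<close>
    then obtain us' where "us = us' @ [z]"
      using z_pos by (cases us rule: rev_cases) (auto simp: u_def)
    then show ?thesis
      by (simp add: fun_eq_iff swap Y_product_Cons Y_Y_eq_0[OF z_pos]
          additive.zero[OF additive_Y_product])
  qed
  moreover have "\<exists>\<nu> w. composition_of m \<nu> \<and> length \<nu> = length \<mu> \<and>
      is_reduced_form
        (biword (\<lambda>i. \<beta> (k + j + i)) ([U] @ segment \<beta> (k + j) @ replicate k L) \<gamma>) w \<and>
      same_word w (code \<nu>) \<and>
      Y_product \<mu> = (\<lambda>f. (- 1) ^ j * Y_product \<nu> f)"
  proof (intro exI conjI)
    \<comment> \<open>The row \<open>z\<close> is reinserted directly below the longer rows.\<close>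
    let ?\<nu> = "rev zs @ rev vs @ z # rev us"
    show "composition_of m ?\<nu>"
      using assms(1) by (auto simp: composition_of_def \<mu>_eq)
    show "length ?\<nu> = length \<mu>" by (simp add: \<mu>_eq)
    show "Y_product \<mu> = (\<lambda>f. (- 1) ^ j * Y_product ?\<nu> f)"
      by (simp add: fun_eq_iff swap Y_product_append Y_product_Cons)
    let ?s = "int (length B1)"
    show "same_word (\<lambda>n. code ?\<nu> (n + ?s)) (code ?\<nu>)"
      by (auto simp: same_word_def)
    have "rev ?\<nu> = (us @ [z]) @ vs @ zs" by simp
    \<comment> \<open>In the path of the new composition \<open>vs\<close> starts from
      \<open>z\<close> and ends at \<open>z + k\<close>, so \<open>zs\<close> now starts from
      \<open>z + k\<close>; deleting pairs in \<open>L^k\<close> followed by the steps of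
      \<open>zs\<close> from \<open>z\<close> gives the same.\<close>
    moreover have "boundary_steps 0 ((us @ [z]) @ vs @ zs) =
        (B1 @ U # B2) @ boundary_steps (z + k) zs"
      using \<open>vs \<noteq> []\<close> last_vs
      unfolding boundary_steps_append [of 0 "us @ [z]" "vs @ zs"] us_z
      by (simp add: boundary_steps_append B2_def)
    ultimately have "boundary_steps 0 (rev ?\<nu>) = (B1 @ U # B2) @ boundary_steps (z + k) zs"
      by simp
    then have "is_reduced_form
        (biword (\<lambda>_. U) ((B1 @ U # B2) @ replicate k L @ boundary_steps z zs) (\<lambda>_. R)) (code ?\<nu>)"
      using deletes_boundary_steps[of "\<lambda>_. U" "B1 @ U # B2" k z zs] reduced_code[of ?\<nu>]
      by (simp add: is_reduced_form_def code_def)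
    moreover have "biword (\<lambda>i. \<beta> (k + j + i)) ([U] @ segment \<beta> (k + j) @ replicate k L) \<gamma> =
        (\<lambda>n. biword (\<lambda>_. U) ((B1 @ U # B2) @ replicate k L @ boundary_steps z zs) (\<lambda>_. R) (n + ?s))"
    proof -
      have "\<beta> (k + j + i) = (if i \<le> length B1 then B1 ! (length B1 - i) else U)" if "i \<ge> 1" for i
      proof -
        have "length B1 - i < length B1" if "i \<le> length B1"
          using that \<open>i \<ge> 1\<close> by simp
        moreover have "length (B1 @ B2) - (k + j + i) = length B1 - i"
          by (simp add: len)
        ultimately show ?thesis
          using \<beta>[of "k + j + i"] that by (simp add: B len nth_append)
      qed
      from biword_eq_shift[OF this \<gamma>, of "[U] @ B2 @ replicate k L"] show ?thesis
        by (simp add: seg_j)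
    qed
    ultimately show "is_reduced_form
        (biword (\<lambda>i. \<beta> (k + j + i)) ([U] @ segment \<beta> (k + j) @ replicate k L) \<gamma>)
        (\<lambda>n. code ?\<nu> (n + ?s))"
      by (simp only: is_reduced_form_shift)
  qed
  ultimately show ?thesis
    using seg_j count by (intro exI[of _ j]) simp
qed

end
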